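(* Let $n\ge 2$. Let $V$ be the free $\mathbb{C}[q,q^{-1}]$-module with basis the set $\mathcal{NC}_n$ of non-crossing partitions of $[n]$, and put $\tau=-(q+q^{-1})$. Let $F_1,\dots,F_{2n-1}$ be the linear operators on $V$ defined below. Then they satisfy the defining relations of the Temperley--Lieb algebra $\mathbb{TL}_{2n}$: - $F_i^2=\tau F_i$ for $1\le i\le 2n-1$; - $F_iF_{i+1}F_i=F_i$ and $F_{i+1}F_iF_{i+1}=F_{i+1}$ for $1\le i\le 2n-2$; - $F_iF_j=F_jF_i$ for $|i-j|>1$. Hence $e_i\mapsto F_i$ defines an action of $\mathbb{TL}_{2n}$ on $V$.
   Context: A non-crossing partition of $[n]$ is a set partition of $[n]$ with no $i<j<k<l$ such that $i,k$ lie in one block and $j,l$ lie in a different block; $\mathcal{NC}_n$ is the set of them. Kreweras endomorphism $\rho$: place points on a circle in clockwise order $1',1,2',2,\dots,n',n$, so that $i'$ lies between $i-1$ and $i$ and $1'$ lies between $n$ and $1$. Then $\rho(\pi)$ is the partition of $[n]$ in which $i,j$ are in the same block if and only if $i',j'$ lie in the same region of the disk cut out by the non-crossing polygons of the blocks of $\pi$. The map $\rho$ is a bijection of $\mathcal{NC}_n$ and is extended linearly to $V$. The operator $f_1$ on basis elements: if $1$ and $2$ lie in the same block of $\pi$, then $f_1\pi=\tau\pi$; otherwise $f_1\pi$ is the partition obtained from $\pi$ by merging the block containing $1$ with the block containing $2$. Extend linearly. Define $F_1:=f_1$ and $F_{i+1}:=\rho F_i\rho^{-1}$ for $1\le i\le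 2n-2$, so that $F_i=\rho^{i-1}f_1\rho^{-(i-1)}$. $\mathbb{TL}_{2n}$ is the unital associative $\mathbb{C}[q,q^{-1}]$-algebra generated by $e_1,\dots,e_{2n-1}$ subject to exactly the relations listed in the claim (with $e$ in place of $F$). *)

theory Defs
  imports
    "HOL-Analysis.Analysis"
    "HOL-Algebra.QuotRing"
    "HOL-Library.Poly_Mapping"
    "HOL-Library.Disjoint_Sets"
begin

section \<open>Non-crossing partitions and the Kreweras map\<close>

definition noncrossing :: "nat set set \<Rightarrow> bool" where
  "noncrossing P \<longleftrightarrow>
     \<not> (\<exists>B\<in>P. \<exists>C\<in>P. B \<noteq> C \<and>
          (\<exists>i j k l. i < j \<and> j < k \<and> k < l \<and> i \<in> B \<and> k \<in> B \<and> j \<in> C \<and> l \<in> C))"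

definition NC :: "nat \<Rightarrow> nat set set set" where
  "NC n = {P. partition_on {1..n} P \<and> noncrossing P}"

text \<open>
  The \<open>2n\<close> points \<open>1', 1, 2', 2, \<dots>, n', n\<close> are equally spaced on the unit circle, in this
  clockwise order; \<open>vertex n i\<close> is the point \<open>i\<close> and \<open>pvertex n i\<close> is the point \<open>i'\<close>.
\<close>

definition vertex :: "nat \<Rightarrow> nat \<Rightarrow> complex" where
  "vertex n i = cis (- (pi * real (2 * i) / real n))"

definition pvertex :: "nat \<Rightarrow> nat \<Rightarrow> complex" where
  "pvertex n i = cis (- (pi * (real (2 * i) - 1) / real n))"

text \<open>
  The polygon of a block is the convex hull of its points (a chord for a block of size two, a
  single point for a singleton block).
\<close>

definition cut_disk :: "nat \<Rightarrow> nat set set \<Rightarrow> complex set" where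
  "cut_disk n P = cball 0 1 - (\<Union>B\<in>P. convex hull (vertex n ` B))"

definition kreweras :: "nat \<Rightarrow> nat set set \<Rightarrow> nat set set" where
  "kreweras n P =
     {1..n} // {(i, j). i \<in> {1..n} \<and> j \<in> {1..n} \<and>
                        connected_component (cut_disk n P) (pvertex n i) (pvertex n j)}"

section \<open>The module \<open>V\<close> and the operators\<close>

text \<open>
  The ring of Laurent polynomials \<open>\<complex>[q, q\<^sup>-\<^sup>1]\<close> is the group algebra of the integers, with
  the convolution product; \<open>q\<close> is the basis element at \<open>1\<close>.
\<close>

type_synonym laurent = "int \<Rightarrow>\<^sub>0 complex"

definition tau :: laurent where
  "tau = - (Poly_Mapping.single 1 1 + Poly_Mapping.single (-1) 1)"

definition lsmult :: "laurent \<Rightarrow> ('b \<Rightarrow>\<^sub>0 laurent) \<Rightarrow> ('b \<Rightarrow>\<^sub>0 laurent)" where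
  "lsmult c v = Poly_Mapping.map (\<lambda>a. c * a) v"

definition V :: "nat \<Rightarrow> (nat set set \<Rightarrow>\<^sub>0 laurent) set" where
  "V n = {v. Poly_Mapping.keys v \<subseteq> NC n}"

definition basis_vec :: "'b \<Rightarrow> ('b \<Rightarrow>\<^sub>0 laurent)" where
  "basis_vec b = Poly_Mapping.single b 1"

definition lin_extend :: "('b \<Rightarrow> ('c \<Rightarrow>\<^sub>0 laurent)) \<Rightarrow> ('b \<Rightarrow>\<^sub>0 laurent) \<Rightarrow> ('c \<Rightarrow>\<^sub>0 laurent)" where
  "lin_extend g v = (\<Sum>b\<in>Poly_Mapping.keys v. lsmult (Poly_Mapping.lookup v b) (g b))"

definition rho :: "nat \<Rightarrow> (nat set set \<Rightarrow>\<^sub>0 laurent) \<Rightarrow> (nat set set \<Rightarrow>\<^sub>0 laurent)" where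
  "rho n = lin_extend (\<lambda>P. basis_vec (kreweras n P))"

definition rho_inv :: "nat \<Rightarrow> (nat set set \<Rightarrow>\<^sub>0 laurent) \<Rightarrow> (nat set set \<Rightarrow>\<^sub>0 laurent)" where
  "rho_inv n = inv_into (V n) (rho n)"

definition block_of :: "nat set set \<Rightarrow> nat \<Rightarrow> nat set" where
  "block_of P i = (THE B. B \<in> P \<and> i \<in> B)"

definition merge12 :: "nat set set \<Rightarrow> nat set set" where
  "merge12 P = insert (block_of P 1 \<union> block_of P 2) (P - {block_of P 1, block_of P 2})"

definition f1 :: "(nat set set \<Rightarrow>\<^sub>0 laurent) \<Rightarrow> (nat set set \<Rightarrow>\<^sub>0 laurent)" where
  "f1 = lin_extend (\<lambda>P. if block_of P 1 = block_of P 2 then lsmult tau (basis_vec P)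
                        else basis_vec (merge12 P))"

text \<open>The operators are indexed from \<open>1\<close>; the value at index \<open>0\<close> is irrelevant.\<close>

fun F :: "nat \<Rightarrow> nat \<Rightarrow> (nat set set \<Rightarrow>\<^sub>0 laurent) \<Rightarrow> (nat set set \<Rightarrow>\<^sub>0 laurent)" where
  "F n 0 = (\<lambda>v. 0)"
| "F n (Suc 0) = f1"
| "F n (Suc (Suc i)) = rho n \<circ> F n (Suc i) \<circ> rho_inv n"

section \<open>The Temperley--Lieb algebra by generators and relations\<close>

text \<open>
  The free monoid, written additively so that the convolution product on finitely supported
  functions makes \<open>'a free_monoid \<Rightarrow>\<^sub>0 laurent\<close> the free associative algebra.
\<close>

datatype 'a free_monoid = Word (letters: "'a list")

instantiation free_monoid :: (type) monoid_add
begin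

definition zero_free_monoid :: "'a free_monoid" where
  "zero_free_monoid = Word []"

definition plus_free_monoid :: "'a free_monoid \<Rightarrow> 'a free_monoid \<Rightarrow> 'a free_monoid" where
  "plus_free_monoid u w = Word (letters u @ letters w)"

instance
  by standard (simp_all add: zero_free_monoid_def plus_free_monoid_def)

end

type_synonym free_alg = "nat free_monoid \<Rightarrow>\<^sub>0 laurent"

definition free_algebra :: "nat set \<Rightarrow> free_alg ring" where
  "free_algebra X =
     \<lparr>carrier = {p. \<forall>w\<in>Poly_Mapping.keys p. set (letters w) \<subseteq> X},
      mult = (*), one = 1, zero = 0, add = (+)\<rparr>"

definition gen :: "nat \<Rightarrow> free_alg" where
  "gen i = Poly_Mapping.single (Word [i]) 1"

definition tl_relators :: "nat \<Rightarrow> free_alg set" where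
  "tl_relators m =
     {gen i * gen i - lsmult tau (gen i) | i. i \<in> {1..m-1}} \<union>
     {gen i * gen (i+1) * gen i - gen i | i. i \<in> {1..m-2}} \<union>
     {gen (i+1) * gen i * gen (i+1) - gen (i+1) | i. i \<in> {1..m-2}} \<union>
     {gen i * gen j - gen j * gen i | i j.
        i \<in> {1..m-1} \<and> j \<in> {1..m-1} \<and> \<bar>int i - int j\<bar> > 1}"

definition tl_ideal :: "nat \<Rightarrow> free_alg set" where
  "tl_ideal m = genideal (free_algebra {1..m-1}) (tl_relators m)"

definition TL :: "nat \<Rightarrow> free_alg set ring" where
  "TL m = free_algebra {1..m-1} Quot tl_ideal m"

definition tl_class :: "nat \<Rightarrow> free_alg \<Rightarrow> free_alg set" where
  "tl_class m p = a_r_coset (free_algebra {1..m-1}) (tl_ideal m) p"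

definition tl_gen :: "nat \<Rightarrow> nat \<Rightarrow> free_alg set" where
  "tl_gen m i = tl_class m (gen i)"

definition tl_scalar :: "nat \<Rightarrow> laurent \<Rightarrow> free_alg set" where
  "tl_scalar m c = tl_class m (lsmult c 1)"

text \<open>
  A left action of the algebra \<open>TL m\<close> on a submodule \<open>W\<close>: unital, multiplicative and bilinear over
  the Laurent polynomials.  The scalar multiple of \<open>x\<close> by \<open>c\<close> in \<open>TL m\<close> is the product of
  \<open>tl_scalar m c\<close> with \<open>x\<close>.
\<close>

definition tl_action ::
  "nat \<Rightarrow> ('b \<Rightarrow>\<^sub>0 laurent) set \<Rightarrow> (free_alg set \<Rightarrow> ('b \<Rightarrow>\<^sub>0 laurent) \<Rightarrow> ('b \<Rightarrow>\<^sub>0 laurent)) \<Rightarrow> bool"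
where
  "tl_action m W act \<longleftrightarrow>
     (\<forall>x\<in>carrier (TL m). \<forall>v\<in>W. act x v \<in> W) \<and>
     (\<forall>x\<in>carrier (TL m). \<forall>v\<in>W. \<forall>w\<in>W. act x (v + w) = act x v + act x w) \<and>
     (\<forall>x\<in>carrier (TL m). \<forall>c. \<forall>v\<in>W. act x (lsmult c v) = lsmult c (act x v)) \<and>
     (\<forall>x\<in>carrier (TL m). \<forall>y\<in>carrier (TL m). \<forall>v\<in>W.
        act (x \<oplus>\<^bsub>TL m\<^esub> y) v = act x v + act y v) \<and>
     (\<forall>c. \<forall>x\<in>carrier (TL m). \<forall>v\<in>W.
        act (tl_scalar m c \<otimes>\<^bsub>TL m\<^esub> x) v = lsmult c (act x v)) \<and>
     (\<forall>x\<in>carrier (TL m). \<forall>y\<in>carrier (TL m). \<forall>v\<in>W.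
        act (x \<otimes>\<^bsub>TL m\<^esub> y) v = act x (act y v)) \<and>
     (\<forall>v\<in>W. act \<one>\<^bsub>TL m\<^esub> v = v)"

end

theory Submission
  imports Defs
begin

text \<open>
  Two primed points lie in the same region iff no chord between two points of one block separates
  them: a chord inside a polygon cuts the disk, and if nothing separates \<open>i'\<close> from \<open>j'\<close> then the
  straight segment between them misses every polygon. Hence \<open>\<rho>\<close> is purely combinatorial, and on
  non-crossing partitions it is inverted by the same construction with the strict inequality
  \<open>x < i\<close> replaced by \<open>x \<le> i\<close>.

  It follows that \<open>\<rho>\<close> turns merging the blocks of \<open>a\<close> and \<open>a + 1\<close> into isolating the point
  \<open>a + 1\<close>, and isolating \<open>c\<close> into merging the blocks of \<open>c\<close> and \<open>c + 1\<close> (cyclically). So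
  \<open>F\<^sub>1, F\<^sub>2, F\<^sub>3, \<dots>\<close> are: merge \<open>1, 2\<close>; isolate \<open>2\<close>; merge \<open>2, 3\<close>; isolate \<open>3\<close>; and so on, up to
  merge \<open>n, 1\<close>. Each of them multiplies by \<open>\<tau>\<close> exactly on the partitions that it fixes, and the
  Temperley--Lieb relations become statements about merging and isolating in arbitrary set
  partitions.
\<close>

section \<open>Regions of the cut disk\<close>

text \<open>Separation of points by a chord is always expressed by comparing truth values such as
  \<open>x < i \<longleftrightarrow> y < i\<close> and
  \<open>x < j \<longleftrightarrow> y < j\<close>. This form does not depend on where the circle is
  cut open, so the step from \<open>n\<close> back to \<open>1\<close> fits the same formulas, and
  biconditionals can be regrouped freely: the statement that \<open>x\<close>, \<open>y\<close> do
  not separate \<open>i'\<close>, \<open>j'\<close> is also the statement that \<open>i'\<close>,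
  \<open>j'\<close> do not separate \<open>x\<close>, \<open>y\<close>. The inequality is strict
  because \<open>i'\<close> comes just before \<open>i\<close>; exchanging the two kinds of points
  negates it, whence \<open>x \<le> i\<close> in the inverse. The delicate point about the operators
  is the power of \<tau>: two products that agree on the underlying partitions could still carry
  different powers. Reading the factor off from fixed partitions makes it visibly invariant under
  the injective map \<rho>, reduces the three-fold products to two non-fixedness statements, and for
  commuting operators leaves an exchange property of the kind known from closure operators.\<close>

definition circle_point :: "nat \<Rightarrow> real \<Rightarrow> complex" where
  "circle_point n p = cis (- (pi * p / real n))"

text \<open>A linear equation of the chord between the circle points at positions \<open>p\<close> and \<open>r\<close>, and of the
  tangent if \<open>p = r\<close>.\<close>

definition chord_side :: "nat \<Rightarrow> real \<Rightarrow> real \<Rightarrow> complex \<Rightarrow> real" where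
  "chord_side n p r z =
     cos (pi * (p - r) / (2 * real n)) - inner (cis (- (pi * (p + r) / (2 * real n)))) z"

lemma vertex_eq_circle_point: "vertex n i = circle_point n (2 * real i)"
  by (simp add: vertex_def circle_point_def)

lemma pvertex_eq_circle_point: "pvertex n i = circle_point n (2 * real i - 1)"
  by (simp add: pvertex_def circle_point_def)

section \<open>Sides of a chord and the order of positions on the circle\<close>

lemma inner_cis: "inner (cis a) (cis b) = cos (a - b)"
  by (simp add: inner_complex_def cos_diff)

text \<open>The normal of the chord points to the mean of the two angles, so on the circle the
  affine function is a difference of two cosines and factors into sines of half angles.\<close>

lemma chord_side_circle_point:
  "chord_side n p r (circle_point n s) =
     2 * sin (pi * (s - p) / (2 * real n)) * sin (pi * (s - r) / (2 * real n))"
proof (cases "n = 0")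
  case True
  then show ?thesis
    by (simp add: chord_side_def circle_point_def inner_cis)
next
  case False
  define a b where "a = pi * (s - p) / (2 * real n)" and "b = pi * (s - r) / (2 * real n)"
  have 1: "pi * (p - r) / (2 * real n) = b - a"
    using False by (simp add: a_def b_def field_simps)
  have 2: "- (pi * (p + r) / (2 * real n)) - (- (pi * s / real n)) = a + b"
    using False by (simp add: a_def b_def field_simps)
  show ?thesis
    unfolding chord_side_def circle_point_def inner_cis 1 2 a_def [symmetric] b_def [symmetric]
    by (simp add: cos_add cos_diff)
qed

lemma sgn_sin_circle:
  assumes "n > 0" "\<bar>t\<bar> < 2 * real n"
  shows "sgn (sin (pi * t / (2 * real n))) = sgn t"
proof -
  have pos: "sin (pi * u / (2 * real n)) > 0" if "0 < u" "u < 2 * real n" for u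
    using that assms(1) by (intro sin_gt_zero) (auto simp: field_simps)
  consider "t = 0" | "t > 0" | "t < 0" by linarith
  then show ?thesis
  proof cases
    case 3
    then show ?thesis using pos [of "- t"] assms by simp
  qed (use pos [of t] assms in auto)
qed

text \<open>The marked points have positions \<open>1\<close> to \<open>2 * n\<close>, so the half
  angles stay strictly between -\<pi> and \<pi>, where the sine has the sign of its argument. From
  here on the side of a chord is a matter of comparing integers.\<close>

lemma sgn_chord_side_circle_point:
  assumes "n > 0" "\<bar>s - p\<bar> < 2 * real n" "\<bar>s - r\<bar> < 2 * real n"
  shows "sgn (chord_side n p r (circle_point n s)) = sgn ((s - p) * (s - r))"
  using assms by (simp add: chord_side_circle_point sgn_mult sgn_sin_circle)

lemma convex_chord_side_pos: "convex {z. chord_side n p r z > 0}"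
  using convex_halfspace_lt by (simp add: chord_side_def)

lemma convex_chord_side_neg: "convex {z. chord_side n p r z < 0}"
  using convex_halfspace_gt by (simp add: chord_side_def)

lemma convex_chord_side_zero: "convex {z. chord_side n p r z = 0}"
proof -
  have "{z. chord_side n p r z = 0} = {z. inner (cis (- (pi * (p + r) / (2 * real n)))) z =
      cos (pi * (p - r) / (2 * real n))}"
    by (auto simp: chord_side_def)
  then show ?thesis by (simp only: convex_hyperplane)
qed

text \<open>Rotating by the conjugate of the normal \<open>m\<close> makes the chord vertical, with
  endpoints \<open>cis (- e)\<close> and \<open>cis e\<close>. A point of that line in the unit disk
  has imaginary part at most \<open>\<bar>sin e\<bar>\<close> in absolute value, hence lies between
  the endpoints.\<close>

lemma chord_in_disk:
  assumes "z \<in> cball 0 1" "chord_side n p r z = 0" "circle_point n p \<noteq> circle_point n r"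
  shows "z \<in> closed_segment (circle_point n p) (circle_point n r)"
proof -
  have n: "n > 0"
    using assms(3) by (auto simp: circle_point_def intro: gr0I)
  define m where "m = cis (- (pi * (p + r) / (2 * real n)))"
  define e where "e = pi * (p - r) / (2 * real n)"
  define w where "w = z * cnj m"
  have m: "cnj m * m = 1" "norm m = 1"
    by (simp_all add: m_def cis_cnj cis_mult)
  have z: "z = m * w"
    using m by (simp add: w_def mult.left_commute mult.commute)
  have P: "circle_point n p = m * cis (- e)" and R: "circle_point n r = m * cis e"
    using n by (simp_all add: circle_point_def m_def e_def cis_mult field_simps)
  have Re: "Re w = cos e"
    using assms(2) by (simp add: chord_side_def m_def [symmetric] e_def [symmetric] w_def
        inner_complex_def)
  have se: "sin e \<noteq> 0"
  proof
    assume "sin e = 0"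
    then have "cis (- e) = cis e" by (simp add: complex_eq_iff)
    then show False using assms(3) P R by simp
  qed
  have "norm w \<le> 1"
    using assms(1) m(2) by (simp add: w_def norm_mult)
  then have "(Re w)\<^sup>2 + (Im w)\<^sup>2 \<le> 1"
    by (simp add: cmod_def)
  moreover have "(cos e)\<^sup>2 + (sin e)\<^sup>2 = 1" by simp
  ultimately have "(Im w)\<^sup>2 \<le> (sin e)\<^sup>2"
    unfolding Re by linarith
  then have im: "\<bar>Im w\<bar> \<le> \<bar>sin e\<bar>"
    by (simp add: abs_le_square_iff)
  \<comment> \<open>Solves \<open>Im w = (2 * u - 1) * sin e\<close>, the imaginary part of the
    convex combination of \<open>cis (- e)\<close> and \<open>cis e\<close> with weights
    \<open>1 - u\<close> and \<open>u\<close>.\<close>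
  define u where "u = (1 + Im w / sin e) / 2"
  have "\<bar>Im w / sin e\<bar> \<le> 1"
    using im se by (simp add: abs_divide)
  then have "- 1 \<le> Im w / sin e" "Im w / sin e \<le> 1"
    by linarith+
  then have u: "0 \<le> u" "u \<le> 1"
    by (simp_all add: u_def)
  have "w = (1 - u) *\<^sub>R cis (- e) + u *\<^sub>R cis e"
    using se by (simp add: complex_eq_iff Re u_def field_simps)
  then have "z = m * ((1 - u) *\<^sub>R cis (- e) + u *\<^sub>R cis e)"
    unfolding z by (rule arg_cong)
  then have "z = (1 - u) *\<^sub>R circle_point n p + u *\<^sub>R circle_point n r"
    unfolding P R by (simp only: distrib_left mult_scaleR_right)
  then show ?thesis
    using u by (auto simp: closed_segment_def)
qed

section \<open>Regions described by separation of primed points\<close>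

definition same_block :: "'a set set \<Rightarrow> 'a \<Rightarrow> 'a \<Rightarrow> bool" where
  "same_block P x y \<longleftrightarrow> (\<exists>B\<in>P. x \<in> B \<and> y \<in> B)"

text \<open>The hypothesis puts every block strictly on one side of the line through
  \<open>i'\<close> and \<open>j'\<close>. Open half-planes are convex, so the hull of the block
  stays on that side and misses the segment. For \<open>i = j\<close> the line is the tangent at
  \<open>i'\<close>, and all vertices lie on its positive side.\<close>

lemma pvertex_segment_subset_cut_disk:
  assumes n: "n > 0" and P: "\<Union>P \<subseteq> {1..n}" and ij: "i \<in> {1..n}" "j \<in> {1..n}"
    and sep: "\<And>x y. same_block P x y \<Longrightarrow> (x < i \<longleftrightarrow> y < i) \<longleftrightarrow> (x < j \<longleftrightarrow> y < j)"
  shows "closed_segment (pvertex n i) (pvertex n j) \<subseteq> cut_disk n P"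
proof -
  define c where "c = chord_side n (2 * real i - 1) (2 * real j - 1)"
  have v: "sgn (c (vertex n x)) = (if (x < i) = (x < j) then 1 else - 1)" if "x \<in> {1..n}" for x
  proof -
    have "sgn (c (vertex n x)) =
        sgn (2 * real x - (2 * real i - 1)) * sgn (2 * real x - (2 * real j - 1))"
      unfolding c_def vertex_eq_circle_point
      by (subst sgn_chord_side_circle_point) (use that n ij in \<open>auto simp: sgn_mult\<close>)
    moreover have "sgn (2 * real x - (2 * real k - 1)) = (if x < k then - 1 else 1)" for k
    proof (cases "x < k")
      case True
      then have "real x + 1 \<le> real k" by simp
      then show ?thesis using True by (simp add: sgn_if)
    next
      case False
      then have "real k \<le> real x" by simp
      then show ?thesis using False by (simp add: sgn_if)
    qed
    ultimately show ?thesis by auto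
  qed
  have seg: "c z = 0" if "z \<in> closed_segment (pvertex n i) (pvertex n j)" for z
  proof -
    have "closed_segment (pvertex n i) (pvertex n j) \<subseteq> {z. c z = 0}"
      unfolding c_def
      by (intro closed_segment_subset convex_chord_side_zero)
        (simp_all add: pvertex_eq_circle_point chord_side_circle_point)
    then show ?thesis using that by auto
  qed
  have hull: "c z \<noteq> 0" if B: "B \<in> P" and z: "z \<in> convex hull (vertex n ` B)" for B z
  proof -
    have sub: "B \<subseteq> {1..n}" using B P by auto
    from z have "B \<noteq> {}" by auto
    then obtain b where b: "b \<in> B" by auto
    \<comment> \<open>This is \<open>sep\<close> with the four truth values regrouped: instead of
      the pair \<open>x\<close>, \<open>b\<close> being seen alike from \<open>i\<close> and
      \<open>j\<close>, the pair \<open>i\<close>, \<open>j\<close> is seen alike from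
      \<open>x\<close> and \<open>b\<close>.\<close>
    have eq: "(x < i \<longleftrightarrow> x < j) \<longleftrightarrow> (b < i \<longleftrightarrow> b < j)" if "x \<in> B" for x
      using sep [of x b] that b B by (auto simp: same_block_def)
    show ?thesis
    proof (cases "(b < i) = (b < j)")
      case True
      have "vertex n ` B \<subseteq> {z. c z > 0}"
      proof (rule image_subsetI)
        fix x assume x: "x \<in> B"
        then have "sgn (c (vertex n x)) = 1"
          using v [of x] eq [OF x] True sub by auto
        then show "vertex n x \<in> {z. c z > 0}" by (simp add: sgn_1_pos)
      qed
      then have "convex hull (vertex n ` B) \<subseteq> {z. c z > 0}"
        unfolding c_def by (intro hull_minimal convex_chord_side_pos)
      then show ?thesis using z by auto
    next
      case False
      have "vertex n ` B \<subseteq> {z. c z < 0}"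
      proof (rule image_subsetI)
        fix x assume x: "x \<in> B"
        then have "sgn (c (vertex n x)) = - 1"
          using v [of x] eq [OF x] False sub by auto
        then show "vertex n x \<in> {z. c z < 0}" by (simp add: sgn_1_neg)
      qed
      then have "convex hull (vertex n ` B) \<subseteq> {z. c z < 0}"
        unfolding c_def by (intro hull_minimal convex_chord_side_neg)
      then show ?thesis using z by auto
    qed
  qed
  have "closed_segment (pvertex n i) (pvertex n j) \<subseteq> cball 0 1"
    by (intro closed_segment_subset) (auto simp: pvertex_def)
  moreover have "z \<notin> (\<Union>B\<in>P. convex hull (vertex n ` B))"
    if "z \<in> closed_segment (pvertex n i) (pvertex n j)" for z
    using hull seg [OF that] by blast
  ultimately show ?thesis
    unfolding cut_disk_def by blast
qed

text \<open>A connected set containing points on both sides of the line through \<open>x\<close> and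
  \<open>y\<close> meets that line. Inside the disk the line is just the chord, and the chord is
  contained in the polygon that has been removed. Only one orientation of the separation is treated;
  the other follows by exchanging \<open>i\<close> and \<open>j\<close>.\<close>

lemma chord_separates_pvertices:
  assumes xy: "x \<in> {1..n}" "y \<in> {1..n}" "same_block P x y" and ij: "i \<in> {1..n}" "j \<in> {1..n}"
    and con: "connected_component (cut_disk n P) (pvertex n i) (pvertex n j)"
    and i: "(x < i) = (y < i)" and j: "(x < j) \<noteq> (y < j)"
  shows False
proof -
  define c where "c = chord_side n (2 * real x) (2 * real y)"
  have n: "n > 0" using ij by auto
  have v: "sgn (c (pvertex n k)) = (if (x < k) = (y < k) then 1 else - 1)" if "k \<in> {1..n}" for k
  proof -
    have "sgn (c (pvertex n k)) = sgn (2 * real k - 1 - 2 * real x) * sgn (2 * real k - 1 - 2 * real y)"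
      unfolding c_def pvertex_eq_circle_point
      by (subst sgn_chord_side_circle_point) (use that n xy in \<open>auto simp: sgn_mult\<close>)
    moreover have "sgn (2 * real k - 1 - 2 * real u) = (if u < k then 1 else - 1)" for u
    proof (cases "u < k")
      case True
      then have "real u + 1 \<le> real k" by simp
      then show ?thesis using True by (simp add: sgn_if)
    next
      case False
      then have "real k \<le> real u" by simp
      then show ?thesis using False by (simp add: sgn_if)
    qed
    ultimately show ?thesis by auto
  qed
  have ci: "c (pvertex n i) > 0" and cj: "c (pvertex n j) < 0"
    using v [OF ij(1)] v [OF ij(2)] i j by (auto simp: sgn_1_pos sgn_1_neg)
  obtain T where T: "connected T" "T \<subseteq> cut_disk n P" "pvertex n i \<in> T" "pvertex n j \<in> T"
    using con by (auto simp: connected_component_def)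
  have "\<exists>z\<in>T. inner (cis (- (pi * (2 * real x + 2 * real y) / (2 * real n)))) z =
      cos (pi * (2 * real x - 2 * real y) / (2 * real n))"
    by (rule connected_ivt_hyperplane [OF T(1,3,4)])
      (use ci cj in \<open>simp_all add: c_def chord_side_def\<close>)
  then obtain z where z: "z \<in> T" "c z = 0"
    unfolding c_def chord_side_def by auto
  obtain B where B: "B \<in> P" "x \<in> B" "y \<in> B"
    using xy(3) by (auto simp: same_block_def)
  \<comment> \<open>The assumption on \<open>j\<close> forces \<open>x\<close> and \<open>y\<close>
    to differ as numbers; that they differ on the circle is seen from the tangent at
    \<open>x\<close>, which contains no other marked point.\<close>
  have ne: "circle_point n (2 * real x) \<noteq> circle_point n (2 * real y)"
  proof
    assume eq: "circle_point n (2 * real x) = circle_point n (2 * real y)"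
    have "chord_side n (2 * real x) (2 * real x) (circle_point n (2 * real x)) = 0"
      by (simp add: chord_side_circle_point)
    moreover have "sgn (chord_side n (2 * real x) (2 * real x) (circle_point n (2 * real y))) \<noteq> 0"
      by (subst sgn_chord_side_circle_point) (use n xy j in \<open>auto simp: sgn_mult sgn_if\<close>)
    ultimately show False unfolding eq by simp
  qed
  have "z \<in> closed_segment (circle_point n (2 * real x)) (circle_point n (2 * real y))"
    using chord_in_disk [OF _ _ ne] z T(2) by (auto simp: c_def cut_disk_def)
  also have "\<dots> \<subseteq> convex hull (vertex n ` B)"
    unfolding vertex_eq_circle_point [symmetric] using B
    by (intro closed_segment_subset) (auto intro: hull_inc)
  finally show False
    using z(1) T(2) B(1) by (auto simp: cut_disk_def)
qed

lemma connected_component_cut_disk_iff: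
  assumes P: "\<Union>P \<subseteq> {1..n}" and ij: "i \<in> {1..n}" "j \<in> {1..n}"
  shows "connected_component (cut_disk n P) (pvertex n i) (pvertex n j) \<longleftrightarrow>
    (\<forall>x y. same_block P x y \<longrightarrow> ((x < i \<longleftrightarrow> y < i) \<longleftrightarrow> (x < j \<longleftrightarrow> y < j)))" (is "?L \<longleftrightarrow> ?R")
proof
  assume L: ?L
  show ?R
  proof (intro allI impI)
    fix x y assume xy: "same_block P x y"
    then have "x \<in> {1..n}" "y \<in> {1..n}" using P by (auto simp: same_block_def)
    note * = chord_separates_pvertices [OF this xy]
    show "(x < i \<longleftrightarrow> y < i) \<longleftrightarrow> (x < j \<longleftrightarrow> y < j)"
      using * [OF ij L] * [OF ij(2,1) connected_component_sym [OF L]] by blast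
  qed
next
  assume R: ?R
  have "closed_segment (pvertex n i) (pvertex n j) \<subseteq> cut_disk n P"
    by (rule pvertex_segment_subset_cut_disk) (use assms R in auto)
  then show ?L
    by (intro connected_componentI [of "closed_segment (pvertex n i) (pvertex n j)"]) auto
qed

section \<open>The Kreweras map on set partitions\<close>

text \<open>The same quotient as in the definition of \<open>kreweras\<close>, with the relation
  left open. Every construction on partitions below is given by its relation, so that equalities of
  partitions reduce to equivalences between \<open>same_block\<close> statements.\<close>

definition part_of :: "nat \<Rightarrow> (nat \<Rightarrow> nat \<Rightarrow> bool) \<Rightarrow> nat set set" where
  "part_of n R = {1..n} // {(x, y). x \<in> {1..n} \<and> y \<in> {1..n} \<and> R x y}"

definition equiv_upto :: "nat \<Rightarrow> (nat \<Rightarrow> nat \<Rightarrow> bool) \<Rightarrow> bool" where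
  "equiv_upto n R \<longleftrightarrow> (\<forall>x\<in>{1..n}. R x x) \<and> (\<forall>x\<in>{1..n}. \<forall>y\<in>{1..n}. R x y \<longrightarrow> R y x) \<and>
     (\<forall>x\<in>{1..n}. \<forall>y\<in>{1..n}. \<forall>z\<in>{1..n}. R x y \<longrightarrow> R y z \<longrightarrow> R x z)"

lemma equiv_of_equiv_upto:
  assumes "equiv_upto n R"
  shows "equiv {1..n} {(x, y). x \<in> {1..n} \<and> y \<in> {1..n} \<and> R x y}" (is "equiv _ ?r")
proof (rule equivI)
  show "?r \<subseteq> {1..n} \<times> {1..n}" by blast
  show "refl_on {1..n} ?r" using assms unfolding equiv_upto_def refl_on_def by blast
  show "sym ?r" using assms unfolding equiv_upto_def sym_def by blast
  show "trans ?r" using assms unfolding equiv_upto_def trans_def by blast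
qed

lemma partition_on_part_of: "equiv_upto n R \<Longrightarrow> partition_on {1..n} (part_of n R)"
  unfolding part_of_def by (intro partition_on_quotient equiv_of_equiv_upto)

lemma same_block_part_of:
  assumes "equiv_upto n R"
  shows "same_block (part_of n R) x y \<longleftrightarrow> x \<in> {1..n} \<and> y \<in> {1..n} \<and> R x y"
proof -
  let ?r = "{(x, y). x \<in> {1..n} \<and> y \<in> {1..n} \<and> R x y}"
  note eq = equiv_of_equiv_upto [OF assms]
  have "same_block (part_of n R) x y \<longleftrightarrow> (x, y) \<in> ?r"
  proof
    assume "same_block (part_of n R) x y"
    then show "(x, y) \<in> ?r"
      unfolding same_block_def part_of_def using quotient_eq_iff [OF eq] by blast
  next
    assume xy: "(x, y) \<in> ?r"
    have q: "?r `` {x} \<in> {1..n} // ?r" using xy by (intro quotientI) auto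
    have x: "x \<in> ?r `` {x}" using xy assms unfolding equiv_upto_def by blast
    have y: "y \<in> ?r `` {x}" using xy by auto
    show "same_block (part_of n R) x y"
      unfolding same_block_def part_of_def by (rule bexI [OF _ q]) (rule conjI [OF x y])
  qed
  then show ?thesis by auto
qed

lemma part_of_cong:
  assumes "\<And>x y. x \<in> {1..n} \<Longrightarrow> y \<in> {1..n} \<Longrightarrow> R x y \<longleftrightarrow> S x y"
  shows "part_of n R = part_of n S"
proof -
  have "{(x, y). x \<in> {1..n} \<and> y \<in> {1..n} \<and> R x y} = {(x, y). x \<in> {1..n} \<and> y \<in> {1..n} \<and> S x y}"
    using assms by auto
  then show ?thesis by (simp only: part_of_def)
qed

lemma part_of_same_block:
  assumes "partition_on {1..n} P"
  shows "part_of n (same_block P) = P"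
proof -
  have "{(x, y). x \<in> {1..n} \<and> y \<in> {1..n} \<and> same_block P x y} = {(x, y). \<exists>p\<in>P. x \<in> p \<and> y \<in> p}"
    using partition_onD1 [OF assms] by (auto simp: same_block_def)
  then show ?thesis
    using partition_on_eq_quotient [OF assms] by (simp only: part_of_def)
qed

lemma partition_eqI:
  fixes n :: nat
  assumes "partition_on {1..n} P" "partition_on {1..n} Q"
    and "\<And>x y. x \<in> {1..n} \<Longrightarrow> y \<in> {1..n} \<Longrightarrow> same_block P x y \<longleftrightarrow> same_block Q x y"
  shows "P = Q"
  using part_of_cong [of n "same_block P" "same_block Q"] assms
  by (simp add: part_of_same_block)

lemma same_block_sym: "same_block P x y \<Longrightarrow> same_block P y x"
  by (auto simp: same_block_def)

lemma same_block_refl: "partition_on {1..n::nat} P \<Longrightarrow> x \<in> {1..n} \<Longrightarrow> same_block P x x"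
  using partition_onD1 [of "{1..n}" P] by (auto simp: same_block_def)

lemma block_unique:
  "partition_on A P \<Longrightarrow> B \<in> P \<Longrightarrow> C \<in> P \<Longrightarrow> x \<in> B \<Longrightarrow> x \<in> C \<Longrightarrow> B = C"
  using partition_onD2 [of A P] disjointD [of P B C] by blast

lemma same_block_trans:
  "partition_on {1..n::nat} P \<Longrightarrow> same_block P x y \<Longrightarrow> same_block P y z \<Longrightarrow> same_block P x z"
  unfolding same_block_def using block_unique [of "{1..n}" P] by metis

lemma same_block_in: "partition_on {1..n::nat} P \<Longrightarrow> same_block P x y \<Longrightarrow> x \<in> {1..n} \<and> y \<in> {1..n}"
  using partition_onD1 [of "{1..n}" P] by (auto simp: same_block_def)

section \<open>Non-crossing partitions in terms of the same-block relation\<close>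

lemma noncrossing_iff_ordered:
  assumes P: "partition_on {1..n} P"
  shows "noncrossing P \<longleftrightarrow> (\<forall>i j k l. i < j \<longrightarrow> j < k \<longrightarrow> k < l \<longrightarrow> same_block P i k \<longrightarrow>
      same_block P j l \<longrightarrow> same_block P i j)" (is "_ \<longleftrightarrow> ?Q")
proof
  assume nc: "noncrossing P"
  show ?Q
  proof (intro allI impI)
    fix i j k l
    assume lt: "i < j" "j < k" "k < l" and "same_block P i k" "same_block P j l"
    then obtain B C where BC: "B \<in> P" "i \<in> B" "k \<in> B" "C \<in> P" "j \<in> C" "l \<in> C"
      unfolding same_block_def by blast
    then have "B = C" using nc lt unfolding noncrossing_def by metis
    then show "same_block P i j" using BC by (auto simp: same_block_def)
  qed
next
  assume Q: ?Q
  have "B = C" if BC: "B \<in> P" "C \<in> P" and lt: "i < j" "j < k" "k < l"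
    and mem: "i \<in> B" "k \<in> B" "j \<in> C" "l \<in> C" for B C i j k l
  proof -
    have "same_block P i k" "same_block P j l" using BC mem by (auto simp: same_block_def)
    then have "same_block P i j" using Q lt by blast
    then obtain D where D: "D \<in> P" "i \<in> D" "j \<in> D" by (auto simp: same_block_def)
    have "D = B" by (rule block_unique [OF P D(1) BC(1) D(2) mem(1)])
    moreover have "D = C" by (rule block_unique [OF P D(1) BC(2) D(3) mem(3)])
    ultimately show ?thesis by simp
  qed
  then show "noncrossing P"
    unfolding noncrossing_def by metis
qed

text \<open>This form says that no pair from one block separates a pair from another. It has no
  assumption on the order of the four points and has the same shape as the criterion for primed
  points, so the two can be combined propositionally.\<close>

lemma noncrossing_iff:
  assumes P: "partition_on {1..n} P"
  shows "noncrossing P \<longleftrightarrow> (\<forall>x y u v. same_block P x y \<longrightarrow> same_block P u v \<longrightarrow> \<not> same_block P x u \<longrightarrow>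
      ((x < u \<longleftrightarrow> y < u) \<longleftrightarrow> (x < v \<longleftrightarrow> y < v)))" (is "_ \<longleftrightarrow> ?R")
proof -
  note trans = same_block_trans [OF P]
    and sym = same_block_sym [of P]
  note A = noncrossing_iff_ordered [OF P]
  show ?thesis unfolding A
  proof
    assume Q: "\<forall>i j k l. i < j \<longrightarrow> j < k \<longrightarrow> k < l \<longrightarrow> same_block P i k \<longrightarrow>
      same_block P j l \<longrightarrow> same_block P i j"
    show ?R
    proof (intro allI impI)
      fix x y u v
      assume xy: "same_block P x y" and uv: "same_block P u v" and xu: "\<not> same_block P x u"
      have yx: "same_block P y x" and vu: "same_block P v u" using xy uv sym by auto
      have ne: "\<not> same_block P x v" "\<not> same_block P y u" "\<not> same_block P y v"
        "\<not> same_block P u x" "\<not> same_block P v x" "\<not> same_block P u y" "\<not> same_block P v y"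
        using xy yx uv vu xu sym trans by blast+
      have neq: "x \<noteq> u" "x \<noteq> v" "y \<noteq> u" "y \<noteq> v"
        using xy uv yx vu ne xu by auto
      \<comment> \<open>If \<open>c\<close> lies between \<open>a\<close> and \<open>b\<close> but
        its partner \<open>d\<close> does not, then \<open>a < c < b < d\<close> or
        \<open>d < a < c < b\<close> is a forbidden pattern.\<close>
      have inside: "a < d \<and> d < b"
        if "same_block P a b" "same_block P c d" "\<not> same_block P a c" "a < c" "c < b"
          "a \<noteq> d" "b \<noteq> d" for a b c d
      proof -
        have "\<not> b < d" using Q that by blast
        moreover have "\<not> d < a"
        proof
          assume "d < a"
          moreover have "same_block P d c" using that(2) by (rule sym)
          ultimately have "same_block P d a" using Q that by blast
          with that(2) have "same_block P c a" by (rule trans)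
          then show False using that(3) sym by blast
        qed
        ultimately show ?thesis using that by linarith
      qed
      note I = inside [OF xy uv xu] inside [OF xy vu ne(1)] inside [OF yx uv ne(2)]
        inside [OF yx vu ne(3)]
      consider "x < y" | "y < x" | "x = y" by linarith
      then show "(x < u \<longleftrightarrow> y < u) \<longleftrightarrow> (x < v \<longleftrightarrow> y < v)"
      proof cases
        case 1
        then show ?thesis using I(1,2) neq by (meson linorder_neqE_nat not_less_iff_gr_or_eq less_trans)
      next
        case 2
        then show ?thesis using I(3,4) neq by (meson linorder_neqE_nat not_less_iff_gr_or_eq less_trans)
      qed simp
    qed
  next
    assume R: ?R
    show "\<forall>i j k l. i < j \<longrightarrow> j < k \<longrightarrow> k < l \<longrightarrow> same_block P i k \<longrightarrow>
      same_block P j l \<longrightarrow> same_block P i j"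
    proof (intro allI impI, rule ccontr)
      fix i j k l
      assume "i < j" "j < k" "k < l" "same_block P i k" "same_block P j l" "\<not> same_block P i j"
      then show False using R [rule_format, of i k j l] by auto
    qed
  qed
qed

lemma NC_D:
  assumes "P \<in> NC n" "same_block P x y" "same_block P u v" "\<not> same_block P x u"
  shows "(x < u \<longleftrightarrow> y < u) \<longleftrightarrow> (x < v \<longleftrightarrow> y < v)"
  using assms noncrossing_iff [of n P] by (simp add: NC_def)

lemma NC_partition: "P \<in> NC n \<Longrightarrow> partition_on {1..n} P"
  by (simp add: NC_def)

text \<open>The side \<open>s i x\<close> will be \<open>x < i\<close> for the Kreweras map and \<open>x \<le> i\<close> for its inverse.\<close>

definition dual :: "nat \<Rightarrow> (nat \<Rightarrow> nat \<Rightarrow> bool) \<Rightarrow> nat set set \<Rightarrow> nat set set" where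
  "dual n s P = part_of n (\<lambda>i j. \<forall>x y. same_block P x y \<longrightarrow> ((s i x \<longleftrightarrow> s i y) \<longleftrightarrow> (s j x \<longleftrightarrow> s j y)))"

lemma equiv_upto_dual:
  "equiv_upto n (\<lambda>i j. \<forall>x y. same_block P x y \<longrightarrow> ((s i x \<longleftrightarrow> s i y) \<longleftrightarrow> (s j x \<longleftrightarrow> s j y)))"
  unfolding equiv_upto_def
proof (intro conjI ballI impI allI)
  fix i j k x y
  assume "\<forall>x y. same_block P x y \<longrightarrow> ((s i x \<longleftrightarrow> s i y) \<longleftrightarrow> (s j x \<longleftrightarrow> s j y))"
    "\<forall>x y. same_block P x y \<longrightarrow> ((s j x \<longleftrightarrow> s j y) \<longleftrightarrow> (s k x \<longleftrightarrow> s k y))" "same_block P x y"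
  then have "(s i x \<longleftrightarrow> s i y) \<longleftrightarrow> (s j x \<longleftrightarrow> s j y)" "(s j x \<longleftrightarrow> s j y) \<longleftrightarrow> (s k x \<longleftrightarrow> s k y)"
    by blast+
  then show "(s i x \<longleftrightarrow> s i y) \<longleftrightarrow> (s k x \<longleftrightarrow> s k y)" by (rule trans)
next
  fix i j x y
  assume "\<forall>x y. same_block P x y \<longrightarrow> ((s i x \<longleftrightarrow> s i y) \<longleftrightarrow> (s j x \<longleftrightarrow> s j y))" "same_block P x y"
  then have "(s i x \<longleftrightarrow> s i y) \<longleftrightarrow> (s j x \<longleftrightarrow> s j y)" by blast
  then show "(s j x \<longleftrightarrow> s j y) \<longleftrightarrow> (s i x \<longleftrightarrow> s i y)" by (rule sym)
qed (rule refl)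

lemma partition_on_dual: "partition_on {1..n} (dual n s P)"
  unfolding dual_def by (rule partition_on_part_of [OF equiv_upto_dual])

lemma same_block_dual:
  "same_block (dual n s P) i j \<longleftrightarrow> i \<in> {1..n} \<and> j \<in> {1..n} \<and>
     (\<forall>x y. same_block P x y \<longrightarrow> ((s i x \<longleftrightarrow> s i y) \<longleftrightarrow> (s j x \<longleftrightarrow> s j y)))"
  unfolding dual_def by (rule same_block_part_of [OF equiv_upto_dual])

lemma kreweras_eq_dual:
  assumes "partition_on {1..n} P"
  shows "kreweras n P = dual n (\<lambda>i x. x < i) P"
proof -
  have "kreweras n P = part_of n (\<lambda>i j. connected_component (cut_disk n P) (pvertex n i) (pvertex n j))"
    by (simp add: kreweras_def part_of_def)
  also have "\<dots> = dual n (\<lambda>i x. x < i) P"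
    unfolding dual_def using partition_onD1 [OF assms]
    by (intro part_of_cong connected_component_cut_disk_iff) auto
  finally show ?thesis .
qed

text \<open>For a fixed pair \<open>a\<close>, \<open>b\<close> the truth value of
  \<open>a < t \<longleftrightarrow> b < t\<close> is constant on an interval and takes the opposite
  value outside it. An interval cannot contain \<open>x\<close>, \<open>y\<close> and avoid
  \<open>u\<close>, \<open>v\<close>, or conversely, when the two pairs interleave; so all four
  points see the same value.\<close>

lemma dual_less_NC:
  assumes P: "partition_on {1..n} P"
  shows "dual n (\<lambda>i x. x < i) P \<in> NC n"
proof -
  let ?D = "dual n (\<lambda>i x. x < i) P"
  have "same_block ?D x u"
    if lt: "x < u" "u < y" "y < v" and xy: "same_block ?D x y" and uv: "same_block ?D u v" for x y u v
    unfolding same_block_dual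
  proof (intro conjI allI impI)
    show "x \<in> {1..n}" "u \<in> {1..n}" using xy uv by (simp_all add: same_block_dual)
    fix a b assume "same_block P a b"
    then have "(a < x \<longleftrightarrow> b < x) \<longleftrightarrow> (a < y \<longleftrightarrow> b < y)" "(a < u \<longleftrightarrow> b < u) \<longleftrightarrow> (a < v \<longleftrightarrow> b < v)"
      using xy uv by (simp_all add: same_block_dual)
    then show "(a < x \<longleftrightarrow> b < x) \<longleftrightarrow> (a < u \<longleftrightarrow> b < u)"
      using lt by linarith
  qed
  note * = this
  have "noncrossing ?D"
    unfolding noncrossing_iff_ordered [OF partition_on_dual] using * by blast
  then show ?thesis unfolding NC_def using partition_on_dual by blast
qed

text \<open>Two points in one block are never separated by two primed points of one region; this
  inclusion is formal. Conversely, if \<open>j\<close> lies outside the block \<open>B\<close> of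
  \<open>i\<close>, some edge of the polygon of \<open>B\<close> cuts \<open>j\<close> off from
  \<open>i\<close>. The two primed points next to the ends of this edge, on the side of
  \<open>j\<close>, lie in one region and separate \<open>i\<close> from \<open>j\<close>.\<close>

lemma dual_le_dual_less:
  assumes "P \<in> NC n"
  shows "dual n (\<lambda>i x. x \<le> i) (dual n (\<lambda>i x. x < i) P) = P"
proof (rule partition_eqI [OF partition_on_dual NC_partition [OF assms]])
  let ?D = "dual n (\<lambda>i x. x < i) P"
  note P = NC_partition [OF assms]
  \<comment> \<open>Both sides record the same incidence: \<open>a \<le> i\<close> is the negation
    of \<open>i < a\<close>, and negating both members of a biconditional changes nothing.\<close>
  have fwd: "(a \<le> i \<longleftrightarrow> b \<le> i) \<longleftrightarrow> (a \<le> j \<longleftrightarrow> b \<le> j)" if "same_block P i j" "same_block ?D a b" for i j a b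
  proof -
    have "(i < a \<longleftrightarrow> j < a) \<longleftrightarrow> (i < b \<longleftrightarrow> j < b)"
      using that by (simp add: same_block_dual)
    then show ?thesis by (simp add: not_less [symmetric]) argo
  qed
  have bwd: "same_block P i j" if i: "i \<in> {1..n}" and j: "j \<in> {1..n}" and ij: "i < j"
    and sep: "\<And>a b. same_block ?D a b \<Longrightarrow> (a \<le> i \<longleftrightarrow> b \<le> i) \<longleftrightarrow> (a \<le> j \<longleftrightarrow> b \<le> j)" for i j
  proof (rule ccontr)
    assume nij: "\<not> same_block P i j"
    define B where "B = {x. same_block P i x}"
    have iB: "i \<in> B" using same_block_refl [OF P i] by (simp add: B_def)
    have BB: "same_block P x y" if "x \<in> B" "y \<in> B" for x y
      using that same_block_sym [of P i x] same_block_trans [OF P, of x i y] by (simp add: B_def)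
    have B: "B \<subseteq> {1..n}" using same_block_in [OF P] by (auto simp: B_def)
    then have finB: "finite B" by (rule finite_subset) simp
    have BC: "(x < u \<longleftrightarrow> y < u) \<longleftrightarrow> (x < v \<longleftrightarrow> y < v)"
      if "x \<in> B" "y \<in> B" "same_block P u v" "u \<notin> B" for x y u v
    proof (rule NC_D [OF assms])
      show "same_block P x y" using BB that by blast
      show "\<not> same_block P x u"
        using that same_block_trans [OF P, of i x u] by (auto simp: B_def)
    qed fact
    have Bcl: "v \<in> B \<longleftrightarrow> u \<in> B" if "same_block P u v" for u v
      using that same_block_trans [OF P] same_block_sym [of P] unfolding B_def by blast
    \<comment> \<open>The near end of the edge of \<open>B\<close> facing \<open>j\<close>; the
      primed point just after it is \<open>Suc m\<close>.\<close>
    define m where "m = Max {x \<in> B. x < j}"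
    have fin: "finite {x \<in> B. x < j}" "{x \<in> B. x < j} \<noteq> {}" using finB iB ij by auto
    have m: "m \<in> B" "m < j" using Max_in [OF fin] by (auto simp: m_def)
    have mmax: "x \<le> m" if "x \<in> B" "x < j" for x
      using that fin by (auto simp: m_def)
    have im: "i \<le> m" using mmax iB ij by simp
    have mn: "Suc m \<in> {1..n}" using m j by auto
    have jB: "j \<notin> B" using nij by (simp add: B_def)
    show False
    proof (cases "\<exists>x\<in>B. j < x")
      case True
      define k where "k = Min {x \<in> B. j < x}"
      have fin: "finite {x \<in> B. j < x}" "{x \<in> B. j < x} \<noteq> {}" using finB True by auto
      have k: "k \<in> B" "j < k" using Min_in [OF fin] by (auto simp: k_def)
      have kmin: "k \<le> x" if "x \<in> B" "j < x" for x
        using that fin by (auto simp: k_def)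
      have gap: "x \<le> m \<or> k \<le> x" if "x \<in> B" for x
        using that mmax kmin jB by (metis linorder_neqE_nat)
      \<comment> \<open>The primed points just after \<open>m\<close> and just before
        \<open>k\<close> are not separated: other blocks do not cross \<open>B\<close>, and
        \<open>B\<close> itself has no point between \<open>m\<close> and \<open>k\<close>.\<close>
      have "same_block ?D (Suc m) k"
        unfolding same_block_dual
      proof (intro conjI allI impI)
        show "Suc m \<in> {1..n}" by fact
        show "k \<in> {1..n}" using k B by auto
        fix u v assume uv: "same_block P u v"
        show "(u < Suc m \<longleftrightarrow> v < Suc m) \<longleftrightarrow> (u < k \<longleftrightarrow> v < k)"
        proof (cases "u \<in> B")
          case True
          then have "v \<in> B" using Bcl [OF uv] by simp
          then show ?thesis using gap [OF True] gap [of v] m k by linarith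
        next
          case False
          then have "v \<notin> B" using Bcl [OF uv] by simp
          with False have "u \<noteq> m" "v \<noteq> m" "u \<noteq> k" "v \<noteq> k" using m k by auto
          then show ?thesis using BC [OF m(1) k(1) uv False] by linarith
        qed
      qed
      from sep [OF this] show False using im m k ij by simp
    next
      case False
      \<comment> \<open>No element of \<open>B\<close> lies beyond \<open>j\<close>, so the edge
        facing \<open>j\<close> runs from the largest element \<open>m\<close> through the cut of
        the circle to the smallest element.\<close>
      define l where "l = Min B"
      have l: "l \<in> B" using iB finB by (auto simp: l_def intro: Min_in)
      have lmin: "l \<le> x" if "x \<in> B" for x using that finB by (auto simp: l_def)
      have gap: "x \<le> m" if "x \<in> B" for x
        using that mmax False jB by (metis linorder_neqE_nat)
      have "same_block ?D (Suc m) l"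
        unfolding same_block_dual
      proof (intro conjI allI impI)
        show "Suc m \<in> {1..n}" by fact
        show "l \<in> {1..n}" using l B by auto
        fix u v assume uv: "same_block P u v"
        show "(u < Suc m \<longleftrightarrow> v < Suc m) \<longleftrightarrow> (u < l \<longleftrightarrow> v < l)"
        proof (cases "u \<in> B")
          case True
          then have "v \<in> B" using Bcl [OF uv] by simp
          then show ?thesis
            using gap [OF True] gap [of v] lmin [OF True] lmin [of v] by linarith
        next
          case False
          then have "v \<notin> B" using Bcl [OF uv] by simp
          with False have "u \<noteq> m" "v \<noteq> m" "u \<noteq> l" "v \<noteq> l" using m l by auto
          then show ?thesis using BC [OF m(1) l uv False] by linarith
        qed
      qed
      from sep [OF this] show False using im m lmin [OF iB] ij by simp
    qed
  qed
  fix i j assume ij: "i \<in> {1..n}" "j \<in> {1..n}"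
  have "same_block P i j" if L: "same_block (dual n (\<lambda>i x. x \<le> i) ?D) i j"
  proof -
    have "\<And>a b. same_block ?D a b \<Longrightarrow> (a \<le> i \<longleftrightarrow> b \<le> i) \<longleftrightarrow> (a \<le> j \<longleftrightarrow> b \<le> j)"
      using L by (simp add: same_block_dual [of n "\<lambda>i x. x \<le> i"])
    then show ?thesis
      using bwd [of i j] bwd [of j i] ij same_block_refl [OF P, of i] same_block_sym [of P j i]
      by (metis linorder_neqE_nat)
  qed
  then show "same_block (dual n (\<lambda>i x. x \<le> i) ?D) i j \<longleftrightarrow> same_block P i j"
    using ij fwd by (auto simp: same_block_dual [of n "\<lambda>i x. x \<le> i" ?D])
qed

lemma finite_NC: "finite (NC n)"
  by (rule finite_subset [of _ "Pow (Pow {1..n})"]) (auto simp: NC_def partition_on_def)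

lemma kreweras_NC: "P \<in> NC n \<Longrightarrow> kreweras n P \<in> NC n"
  by (simp only: kreweras_eq_dual NC_partition dual_less_NC)

lemma inj_on_kreweras: "inj_on (kreweras n) (NC n)"
  by (rule inj_on_inverseI [of _ "dual n (\<lambda>i x. x \<le> i)"])
    (simp only: kreweras_eq_dual NC_partition dual_le_dual_less)

text \<open>Surjectivity comes from counting: the left inverse gives injectivity, and an injective
  self-map of a finite set is onto.\<close>

lemma kreweras_image_NC: "kreweras n ` NC n = NC n"
  by (rule endo_inj_surj [OF finite_NC _ inj_on_kreweras]) (auto intro: kreweras_NC)

section \<open>Merging blocks and isolating points\<close>

text \<open>The relation also makes sense when \<open>a\<close> and \<open>b\<close> already share a
  block; the result is then \<open>P\<close> itself, so being fixed is exactly the condition under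
  which the operator produces a factor \<tau>.\<close>

definition merge_blocks :: "nat \<Rightarrow> nat \<Rightarrow> nat \<Rightarrow> nat set set \<Rightarrow> nat set set" where
  "merge_blocks n a b P = part_of n (\<lambda>x y. same_block P x y \<or>
     (same_block P x a \<or> same_block P x b) \<and> (same_block P y a \<or> same_block P y b))"

definition isolate :: "nat \<Rightarrow> nat \<Rightarrow> nat set set \<Rightarrow> nat set set" where
  "isolate n c P = part_of n (\<lambda>x y. x = y \<or> same_block P x y \<and> x \<noteq> c \<and> y \<noteq> c)"

lemma merge_commute_args: "merge_blocks n a b P = merge_blocks n b a P"
  unfolding merge_blocks_def by (intro part_of_cong) blast

context
  fixes n :: nat and P :: "nat set set"
  assumes P: "partition_on {1..n} P"
begin

lemma equiv_upto_merge:
  "equiv_upto n (\<lambda>x y. same_block P x y \<or>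
     (same_block P x a \<or> same_block P x b) \<and> (same_block P y a \<or> same_block P y b))"
proof -
  have U: "same_block P x e" if "same_block P x y" "same_block P y e" for x y e
    using that by (rule same_block_trans [OF P])
  show ?thesis
    unfolding equiv_upto_def
    by (intro conjI ballI impI) (use same_block_refl [OF P] same_block_sym [of P] U in metis)+
qed

lemma equiv_upto_isolate:
  "equiv_upto n (\<lambda>x y. x = y \<or> same_block P x y \<and> x \<noteq> c \<and> y \<noteq> c)"
  unfolding equiv_upto_def
  by (intro conjI ballI impI) (use same_block_sym [of P] same_block_trans [OF P] in metis)+

lemmas partition_on_merge = partition_on_part_of [OF equiv_upto_merge, folded merge_blocks_def]
lemmas partition_on_isolate = partition_on_part_of [OF equiv_upto_isolate, folded isolate_def]
lemmas same_block_merge = same_block_part_of [OF equiv_upto_merge, folded merge_blocks_def]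
lemmas same_block_isolate = same_block_part_of [OF equiv_upto_isolate, folded isolate_def]

lemma same_block_merge_mono: "same_block P x y \<Longrightarrow> same_block (merge_blocks n a b P) x y"
  using same_block_in [OF P] by (simp only: same_block_merge) blast

lemma same_block_merge_ends:
  "a \<in> {1..n} \<Longrightarrow> b \<in> {1..n} \<Longrightarrow> same_block (merge_blocks n a b P) a b"
  using same_block_refl [OF P] by (simp only: same_block_merge) blast

text \<open>The universal property: merging gives the finest coarsening of \<open>P\<close> in which
  \<open>a\<close> and \<open>b\<close> share a block. Several identities below follow from it
  without unfolding the defining relation.\<close>

lemma merge_least:
  assumes Q: "partition_on {1..n} Q" "\<And>x y. same_block P x y \<Longrightarrow> same_block Q x y" "same_block Q a b"
    and xy: "same_block (merge_blocks n a b P) x y"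
  shows "same_block Q x y"
proof -
  have U: "same_block Q z a" if "same_block P z a \<or> same_block P z b" for z
    using that Q(2) same_block_trans [OF Q(1) _ same_block_sym [OF Q(3)]] by blast
  from xy consider "same_block P x y"
    | "same_block P x a \<or> same_block P x b" "same_block P y a \<or> same_block P y b"
    unfolding same_block_merge by blast
  then show ?thesis
  proof cases
    case 2
    then show ?thesis using U same_block_trans [OF Q(1)] same_block_sym by metis
  qed (rule Q(2))
qed

lemma merge_fixed_iff:
  assumes "a \<in> {1..n}" "b \<in> {1..n}"
  shows "merge_blocks n a b P = P \<longleftrightarrow> same_block P a b"
proof
  assume "merge_blocks n a b P = P"
  then show "same_block P a b" using same_block_merge_ends [OF assms] by simp
next
  assume "same_block P a b"
  then show "merge_blocks n a b P = P"
    using merge_least [OF P] same_block_merge_mono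
    by (intro partition_eqI [OF partition_on_merge P]) blast
qed

lemma isolate_fixed_iff:
  assumes "c \<in> {1..n}"
  shows "isolate n c P = P \<longleftrightarrow> (\<forall>y. same_block P c y \<longrightarrow> y = c)"
proof
  assume "isolate n c P = P"
  then show "\<forall>y. same_block P c y \<longrightarrow> y = c" using same_block_isolate [of c c] by metis
next
  assume c: "\<forall>y. same_block P c y \<longrightarrow> y = c"
  show "isolate n c P = P"
  proof (rule partition_eqI [OF partition_on_isolate P])
    fix x y assume "x \<in> {1..n}" "y \<in> {1..n}"
    then show "same_block (isolate n c P) x y \<longleftrightarrow> same_block P x y"
      unfolding same_block_isolate using c same_block_sym [of P] same_block_refl [OF P] by metis
  qed
qed

end

text \<open>Since \<open>b\<close> differs from \<open>a\<close>, it stays behind in the rest of the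
  old block, and joining \<open>a\<close> to \<open>b\<close> restores that block. Together with
  \<open>isolate_merge_isolated\<close> this yields the three-fold relations.\<close>

lemma merge_isolate_same_block:
  assumes P: "partition_on {1..n} P" and ab: "same_block P a b" "a \<noteq> b"
  shows "merge_blocks n a b (isolate n a P) = P"
proof (rule partition_eqI [OF partition_on_merge [OF partition_on_isolate [OF P]] P])
  fix x y assume xy: "x \<in> {1..n}" "y \<in> {1..n}"
  note I = partition_on_isolate [OF P, of a]
  have "same_block P x y" if "same_block (merge_blocks n a b (isolate n a P)) x y"
    using same_block_refl [OF P] ab(1)
    by (intro merge_least [OF I P _ _ that]) (auto simp: same_block_isolate [OF P])
  moreover have "same_block (merge_blocks n a b (isolate n a P)) x y" if "same_block P x y"
  proof -
    have *: "same_block (isolate n a P) z a \<or> same_block (isolate n a P) z b"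
      if "same_block P z a" for z
      using that ab same_block_trans [OF P, of z a b] same_block_in [OF P, of z b]
        same_block_in [OF P, of z a]
      unfolding same_block_isolate [OF P] by blast
    have "same_block P x a \<and> same_block P y a \<or> x \<noteq> a \<and> y \<noteq> a"
      using that same_block_sym [OF that] same_block_refl [OF P] xy by blast
    then show ?thesis
      using * xy that unfolding same_block_merge [OF I] by (auto simp: same_block_isolate [OF P])
  qed
  ultimately show "same_block (merge_blocks n a b (isolate n a P)) x y \<longleftrightarrow> same_block P x y" by blast
qed

lemma isolate_merge_isolated:
  assumes P: "partition_on {1..n} P" and a: "\<And>y. same_block P a y \<Longrightarrow> y = a"
  shows "isolate n a (merge_blocks n a b P) = P"
proof (rule partition_eqI [OF partition_on_isolate [OF partition_on_merge [OF P]] P])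
  fix x y assume xy: "x \<in> {1..n}" "y \<in> {1..n}"
  have a': "z = a" if "same_block P z a" for z by (rule a [OF same_block_sym [OF that]])
  have "same_block P x y" if "same_block P x b" "same_block P y b"
    using that same_block_trans [OF P] same_block_sym by metis
  then have "same_block (isolate n a (merge_blocks n a b P)) x y \<longleftrightarrow>
      x = y \<or> same_block P x y \<and> x \<noteq> a \<and> y \<noteq> a"
    unfolding same_block_isolate [OF partition_on_merge [OF P]] same_block_merge [OF P]
    using a' [of x] a' [of y] xy by auto
  also have "\<dots> \<longleftrightarrow> same_block P x y"
    using a [of y] a' [of x] same_block_refl [OF P xy(1)] by auto
  finally show "same_block (isolate n a (merge_blocks n a b P)) x y \<longleftrightarrow> same_block P x y" .
qed

lemma isolated_isolate:
  "partition_on {1..n} P \<Longrightarrow> same_block (isolate n a P) a y \<Longrightarrow> y = a"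
  by (simp only: same_block_isolate) blast

text \<open>Both sides are the finest coarsening of \<open>P\<close> that joins \<open>a\<close>
  with \<open>b\<close> and \<open>c\<close> with \<open>d\<close>; each inclusion is two
  applications of the universal property.\<close>

lemma merge_commute:
  assumes P: "partition_on {1..n} P" and "a \<in> {1..n}" "b \<in> {1..n}" "c \<in> {1..n}" "d \<in> {1..n}"
  shows "merge_blocks n a b (merge_blocks n c d P) = merge_blocks n c d (merge_blocks n a b P)"
proof -
  have *: "same_block (merge_blocks n c d (merge_blocks n a b P)) x y"
    if ab: "a \<in> {1..n}" "b \<in> {1..n}" and cd: "c \<in> {1..n}" "d \<in> {1..n}"
      and xy: "same_block (merge_blocks n a b (merge_blocks n c d P)) x y" for a b c d x y
  proof (rule merge_least [OF partition_on_merge [OF P] partition_on_merge [OF partition_on_merge [OF P]] _ _ xy])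
    note M = partition_on_merge [OF P]
    show "same_block (merge_blocks n c d (merge_blocks n a b P)) a b"
      by (intro same_block_merge_mono [OF M] same_block_merge_ends [OF P] ab)
    fix u v assume "same_block (merge_blocks n c d P) u v"
    then show "same_block (merge_blocks n c d (merge_blocks n a b P)) u v"
      by (rule merge_least [OF P partition_on_merge [OF M], rotated 2])
        (intro same_block_merge_mono [OF M] same_block_merge_mono [OF P] same_block_merge_ends [OF M] cd; assumption?)+
  qed
  show ?thesis
    by (rule partition_eqI [OF partition_on_merge [OF partition_on_merge [OF P]]
          partition_on_merge [OF partition_on_merge [OF P]]])
      (use * [OF assms(2-5)] * [OF assms(4,5,2,3)] in blast)
qed

lemma isolate_commute:
  assumes P: "partition_on {1..n} P"
  shows "isolate n c (isolate n d P) = isolate n d (isolate n c P)"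
proof (rule partition_eqI [OF partition_on_isolate [OF partition_on_isolate [OF P]]
      partition_on_isolate [OF partition_on_isolate [OF P]]])
  fix x y
  show "same_block (isolate n c (isolate n d P)) x y \<longleftrightarrow> same_block (isolate n d (isolate n c P)) x y"
    unfolding same_block_isolate [OF partition_on_isolate [OF P]] same_block_isolate [OF P] by blast
qed

lemma merge_isolate_commute:
  assumes P: "partition_on {1..n} P" and ab: "a \<in> {1..n}" "b \<in> {1..n}" and c: "c \<noteq> a" "c \<noteq> b"
  shows "merge_blocks n a b (isolate n c P) = isolate n c (merge_blocks n a b P)"
proof (rule partition_eqI [OF partition_on_merge [OF partition_on_isolate [OF P]]
      partition_on_isolate [OF partition_on_merge [OF P]]])
  fix x y assume "x \<in> {1..n}" "y \<in> {1..n}"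
  then show "same_block (merge_blocks n a b (isolate n c P)) x y \<longleftrightarrow> same_block (isolate n c (merge_blocks n a b P)) x y"
    unfolding same_block_isolate [OF partition_on_merge [OF P]] same_block_merge [OF P]
      same_block_merge [OF partition_on_isolate [OF P]] same_block_isolate [OF P]
    using ab c same_block_refl [OF P] by metis
qed

text \<open>The exchange axiom of the graphic matroid: if joining \<open>c\<close> and
  \<open>d\<close> is what connects \<open>a\<close> with \<open>b\<close>, then \<open>a\<close>
  and \<open>b\<close> lie in the blocks of \<open>c\<close> and \<open>d\<close> in some order, so
  joining \<open>a\<close> and \<open>b\<close> connects \<open>c\<close> with
  \<open>d\<close>.\<close>

lemma merge_exchange:
  assumes P: "partition_on {1..n} P" and ab: "a \<in> {1..n}" "b \<in> {1..n}" and cd: "c \<in> {1..n}" "d \<in> {1..n}"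
    and nab: "\<not> same_block P a b" and *: "same_block (merge_blocks n c d P) a b"
  shows "same_block (merge_blocks n a b P) c d"
proof -
  have "same_block P a c \<and> same_block P b d \<or> same_block P a d \<and> same_block P b c"
    using * nab same_block_trans [OF P] same_block_sym [of P] unfolding same_block_merge [OF P] by metis
  then show ?thesis
    using cd same_block_sym [of P] unfolding same_block_merge [OF P] by blast
qed

text \<open>The counterpart for isolating: if \<open>c\<close> is not a singleton but becomes one
  once \<open>d\<close> is removed, with \<open>c\<close> and \<open>d\<close> distinct, then its
  block is exactly the pair of \<open>c\<close> and \<open>d\<close>, a symmetric condition.\<close>

lemma isolate_exchange:
  assumes P: "partition_on {1..n} P" and cd: "c \<in> {1..n}" "d \<in> {1..n}"
    and nc: "isolate n c P \<noteq> P" and *: "isolate n c (isolate n d P) = isolate n d P"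
  shows "isolate n d (isolate n c P) = isolate n c P"
proof -
  have 1: "y = c" if "same_block P c y" "y \<noteq> d" "c \<noteq> d" for y
    using * [unfolded isolate_fixed_iff [OF partition_on_isolate [OF P] cd(1)]] that
      same_block_in [OF P that(1)]
    unfolding same_block_isolate [OF P] by blast
  obtain y where y: "same_block P c y" "y \<noteq> c"
    using nc unfolding isolate_fixed_iff [OF P cd(1)] by blast
  show ?thesis
  proof (cases "c = d")
    case True
    then show ?thesis using * by simp
  next
    case False
    then have "same_block P c d" using 1 y by metis
    then have "z = d" if "same_block P d z" "z \<noteq> c" for z
      using 1 [of z] False that same_block_trans [OF P, of c d z] by blast
    then show ?thesis
      unfolding isolate_fixed_iff [OF partition_on_isolate [OF P] cd(2)] same_block_isolate [OF P]
      by blast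
  qed
qed

lemma merge_fixed_isolate_iff:
  assumes P: "partition_on {1..n} P" and ab: "a \<in> {1..n}" "b \<in> {1..n}" and c: "c \<noteq> a" "c \<noteq> b"
  shows "merge_blocks n a b (isolate n c P) = isolate n c P \<longleftrightarrow> merge_blocks n a b P = P"
  unfolding merge_fixed_iff [OF P ab] merge_fixed_iff [OF partition_on_isolate [OF P] ab]
    same_block_isolate [OF P]
  using ab c same_block_refl [OF P] by metis

lemma isolate_fixed_merge_iff:
  assumes P: "partition_on {1..n} P" and c: "c \<in> {1..n}" "c \<noteq> a" "c \<noteq> b"
  shows "isolate n c (merge_blocks n a b P) = merge_blocks n a b P \<longleftrightarrow> isolate n c P = P"
proof -
  have "(\<forall>y. same_block (merge_blocks n a b P) c y \<longrightarrow> y = c) \<longleftrightarrow> (\<forall>y. same_block P c y \<longrightarrow> y = c)"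
    unfolding same_block_merge [OF P] using c same_block_in [OF P] by metis
  then show ?thesis
    unfolding isolate_fixed_iff [OF P c(1)] isolate_fixed_iff [OF partition_on_merge [OF P] c(1)] .
qed

text \<open>The hypothesis on \<open>c\<close> says that the chord from \<open>a\<close> to
  \<open>b\<close> separates the dual point \<open>c\<close> from all other dual points. Adding this
  chord therefore makes \<open>c\<close> a singleton and imposes nothing new on the rest. The
  hypothesis compares truth values by a negation, so it also covers \<open>n\<close> and
  \<open>1\<close>, where the two values are swapped. The side \<open>s\<close> is kept general
  because both the Kreweras map and its inverse are needed.\<close>

lemma dual_merge:
  assumes P: "partition_on {1..n} P" and ab: "a \<in> {1..n}" "b \<in> {1..n}"
    and c: "\<And>i. i \<in> {1..n} \<Longrightarrow> i \<noteq> c \<Longrightarrow> (s i a \<longleftrightarrow> s i b) \<longleftrightarrow> \<not> (s c a \<longleftrightarrow> s c b)"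
  shows "dual n s (merge_blocks n a b P) = isolate n c (dual n s P)"
proof (rule partition_eqI [OF partition_on_dual partition_on_isolate [OF partition_on_dual]])
  fix i j assume ij: "i \<in> {1..n}" "j \<in> {1..n}"
  let ?M = "merge_blocks n a b P"
  have "i = j \<or> same_block (dual n s P) i j \<and> i \<noteq> c \<and> j \<noteq> c"
    if L: "same_block (dual n s ?M) i j"
  proof (cases "i = j")
    case False
    have *: "(s i x \<longleftrightarrow> s i y) \<longleftrightarrow> (s j x \<longleftrightarrow> s j y)" if "same_block ?M x y" for x y
      using L that unfolding same_block_dual by blast
    have "same_block (dual n s P) i j"
      unfolding same_block_dual using ij * same_block_merge_mono [OF P] by blast
    moreover have "i \<noteq> c" "j \<noteq> c"
      using * [OF same_block_merge_ends [OF P ab]] c [OF ij(1)] c [OF ij(2)] False by auto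
    ultimately show ?thesis by blast
  qed simp
  moreover have "same_block (dual n s ?M) i j"
    if D: "same_block (dual n s P) i j" and ne: "i \<noteq> c" "j \<noteq> c"
    unfolding same_block_dual
  proof (intro conjI allI impI ij)
    have *: "(s i x \<longleftrightarrow> s i y) \<longleftrightarrow> (s j x \<longleftrightarrow> s j y)" if "same_block P x y" for x y
      using D that unfolding same_block_dual by blast
    have e: "(s i a \<longleftrightarrow> s i b) \<longleftrightarrow> (s j a \<longleftrightarrow> s j b)"
      using c [OF ij(1) ne(1)] c [OF ij(2) ne(2)] by simp
    have U: "(s i x \<longleftrightarrow> s i a) \<longleftrightarrow> (s j x \<longleftrightarrow> s j a)" if "same_block P x a \<or> same_block P x b" for x
      using * [of x a] * [of x b] e that by argo
    fix x y assume "same_block ?M x y"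
    then consider "same_block P x y"
      | "same_block P x a \<or> same_block P x b" "same_block P y a \<or> same_block P y b"
      unfolding same_block_merge [OF P] by blast
    then show "(s i x \<longleftrightarrow> s i y) \<longleftrightarrow> (s j x \<longleftrightarrow> s j y)"
    proof cases
      case 2
      then show ?thesis using U [OF 2(1)] U [OF 2(2)] by argo
    qed (rule *)
  qed
  moreover have "same_block (dual n s ?M) i j" if "i = j"
    using that same_block_refl [OF partition_on_dual] ij by blast
  ultimately show "same_block (dual n s ?M) i j \<longleftrightarrow> same_block (isolate n c (dual n s P)) i j"
    unfolding same_block_isolate [OF partition_on_dual] using ij by blast
qed

lemma isolate_NC:
  assumes P: "P \<in> NC n"
  shows "isolate n c P \<in> NC n"
proof -
  note Pp = NC_partition [OF P]
  have "noncrossing (isolate n c P)"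
    unfolding noncrossing_iff [OF partition_on_isolate [OF Pp]]
  proof (intro allI impI)
    fix x y u v
    assume xy: "same_block (isolate n c P) x y" and uv: "same_block (isolate n c P) u v"
      and xu: "\<not> same_block (isolate n c P) x u"
    show "(x < u \<longleftrightarrow> y < u) \<longleftrightarrow> (x < v \<longleftrightarrow> y < v)"
    proof (cases "x = y \<or> u = v")
      case False
      then have "same_block P x y" "same_block P u v" "\<not> same_block P x u"
        using xy uv xu unfolding same_block_isolate [OF Pp] by blast+
      then show ?thesis by (rule NC_D [OF P])
    qed auto
  qed
  then show ?thesis
    unfolding NC_def using partition_on_isolate [OF Pp] by blast
qed

section \<open>Cyclic neighbours, and the Kreweras map as a shift of the operators\<close>

definition cyc_succ :: "nat \<Rightarrow> nat \<Rightarrow> nat" where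
  "cyc_succ n a = (if a = n then 1 else Suc a)"

lemma cyc_succ_in: "a \<in> {1..n} \<Longrightarrow> cyc_succ n a \<in> {1..n}"
  by (auto simp: cyc_succ_def)

text \<open>Cyclic neighbours cannot be separated by a pair of points other than themselves; this is
  \<open>H\<close>. Any \<open>z\<close> in the merged block \<open>U\<close> lies in the old block
  of \<open>a\<close> or of \<open>b\<close>, hence on the same side of a pair outside
  \<open>U\<close> as that point, and by \<open>H\<close> all of \<open>U\<close> lies on one side.
  The condition has to be checked with \<open>U\<close> in either role.\<close>

lemma merge_cyc_succ_NC:
  assumes P: "P \<in> NC n" and a: "a \<in> {1..n}"
  shows "merge_blocks n a (cyc_succ n a) P \<in> NC n"
proof -
  define b where "b = cyc_succ n a"
  note Pp = NC_partition [OF P]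
  let ?M = "merge_blocks n a b P"
  define U where "U = (\<lambda>x. same_block P x a \<or> same_block P x b)"
  have M: "same_block ?M x y \<longleftrightarrow> x \<in> {1..n} \<and> y \<in> {1..n} \<and> (same_block P x y \<or> U x \<and> U y)" for x y
    unfolding U_def by (rule same_block_merge [OF Pp])
  have Ucl: "U x" if "same_block P x y" "U y" for x y
    using that same_block_trans [OF Pp] unfolding U_def by blast
  have bn: "b \<in> {1..n}" unfolding b_def using a by (rule cyc_succ_in)
  have Uab: "U a" "U b" using same_block_refl [OF Pp] a bn by (auto simp: U_def)
  have H: "(a < u \<longleftrightarrow> b < u) \<longleftrightarrow> (a < v \<longleftrightarrow> b < v)" "(u < a \<longleftrightarrow> v < a) \<longleftrightarrow> (u < b \<longleftrightarrow> v < b)"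
    if "u \<in> {1..n}" "v \<in> {1..n}" "\<not> U u" "\<not> U v" for u v
  proof -
    have ne: "u \<noteq> a" "u \<noteq> b" "v \<noteq> a" "v \<noteq> b" using that Uab by auto
    show "(a < u \<longleftrightarrow> b < u) \<longleftrightarrow> (a < v \<longleftrightarrow> b < v)" "(u < a \<longleftrightarrow> v < a) \<longleftrightarrow> (u < b \<longleftrightarrow> v < b)"
      using ne that(1,2) unfolding b_def cyc_succ_def by (auto split: if_splits)
  qed
  have "noncrossing ?M"
    unfolding noncrossing_iff [OF partition_on_merge [OF Pp]]
  proof (intro allI impI)
    fix x y u v
    assume xy: "same_block ?M x y" and uv: "same_block ?M u v" and xu: "\<not> same_block ?M x u"
    have mem: "x \<in> {1..n}" "y \<in> {1..n}" "u \<in> {1..n}" "v \<in> {1..n}" using xy uv unfolding M by auto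
    have nxu: "\<not> same_block P x u" "\<not> (U x \<and> U u)" using xu mem unfolding M by auto
    consider (PP) "same_block P x y" "same_block P u v" | (PU) "same_block P x y" "U u" "U v" "\<not> U x"
      | (UP) "U x" "U y" "same_block P u v" "\<not> U u"
      using xy uv nxu unfolding M by blast
    then show "(x < u \<longleftrightarrow> y < u) \<longleftrightarrow> (x < v \<longleftrightarrow> y < v)"
    proof cases
      case PP
      then show ?thesis using NC_D [OF P] nxu by blast
    next
      case PU
      have nUy: "\<not> U y" using Ucl [OF PU(1)] PU(4) by blast
      have nU: "\<not> same_block P x z" if "U z" for z using that PU(4) Ucl [of x z] by blast
      have *: "(x < z \<longleftrightarrow> y < z) \<longleftrightarrow> (x < a \<longleftrightarrow> y < a)" if "U z" for z
        using that NC_D [OF P PU(1) _ nU [OF that], of a] NC_D [OF P PU(1) _ nU [OF that], of b]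
          H(2) [OF mem(1,2) PU(4) nUy] unfolding U_def by argo
      show ?thesis using * [OF PU(2)] * [OF PU(3)] by argo
    next
      case UP
      have nUv: "\<not> U v" using Ucl [OF UP(3)] UP(4) by blast
      have nU: "\<not> same_block P z u" if "U z" for z
        using that UP(4) Ucl [OF same_block_sym, of z u] by blast
      have *: "(z < u \<longleftrightarrow> a < u) \<longleftrightarrow> (z < v \<longleftrightarrow> a < v)" if "U z" for z
        using that NC_D [OF P _ UP(3) nU [OF that], of a] NC_D [OF P _ UP(3) nU [OF that], of b]
          H(1) [OF mem(3,4) UP(4) nUv] unfolding U_def by argo
      show ?thesis using * [OF UP(1)] * [OF UP(2)] by argo
    qed
  qed
  then show ?thesis
    unfolding NC_def b_def using partition_on_merge [OF Pp] by blast
qed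

lemma kreweras_merge:
  assumes P: "P \<in> NC n" and a: "1 \<le> a" "a < n"
  shows "kreweras n (merge_blocks n a (Suc a) P) = isolate n (Suc a) (kreweras n P)"
  unfolding kreweras_eq_dual [OF partition_on_merge [OF NC_partition [OF P]]]
    kreweras_eq_dual [OF NC_partition [OF P]]
  by (rule dual_merge [OF NC_partition [OF P]]) (use a in auto)

text \<open>Since \<open>dual_merge\<close> only turns merging into isolating, the claim is proved
  backwards: the right-hand side is non-crossing, so it is the image of some \<open>R\<close>, and
  applying the inverse with side \<open>x \<le> i\<close> identifies \<open>R\<close> as
  \<open>isolate n c P\<close>.\<close>

lemma kreweras_isolate:
  assumes P: "P \<in> NC n" and c: "c \<in> {1..n}"
  shows "kreweras n (isolate n c P) = merge_blocks n c (cyc_succ n c) (kreweras n P)"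
proof -
  let ?Q = "merge_blocks n c (cyc_succ n c) (kreweras n P)"
  have inv: "dual n (\<lambda>i x. x \<le> i) (kreweras n R) = R" if "R \<in> NC n" for R
    using dual_le_dual_less [OF that] unfolding kreweras_eq_dual [OF NC_partition [OF that]] .
  have "?Q \<in> kreweras n ` NC n"
    unfolding kreweras_image_NC by (rule merge_cyc_succ_NC [OF kreweras_NC [OF P] c])
  then obtain R where R: "R \<in> NC n" "?Q = kreweras n R" by blast
  have "R = dual n (\<lambda>i x. x \<le> i) ?Q" using R inv by simp
  also have "\<dots> = isolate n c (dual n (\<lambda>i x. x \<le> i) (kreweras n P))"
    by (rule dual_merge [OF NC_partition [OF kreweras_NC [OF P]] c cyc_succ_in [OF c]])
      (use c in \<open>auto simp: cyc_succ_def\<close>)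
  also have "\<dots> = isolate n c P" by (simp only: inv [OF P])
  finally show ?thesis using R by simp
qed

text \<open>The effect of \<open>F\<^sub>i\<close> on basis elements, up to powers of \<open>\<tau>\<close>.\<close>

definition tl_map :: "nat \<Rightarrow> nat \<Rightarrow> nat set set \<Rightarrow> nat set set" where
  "tl_map n i = (if odd i then merge_blocks n (Suc i div 2) (cyc_succ n (Suc i div 2))
                 else isolate n (Suc (i div 2)))"

lemma tl_map_NC:
  assumes "P \<in> NC n" "i \<in> {1..2*n-1}"
  shows "tl_map n i P \<in> NC n"
proof (cases "odd i")
  case True
  have "Suc i div 2 \<in> {1..n}" using assms(2) by auto
  then show ?thesis using True merge_cyc_succ_NC assms(1) by (simp add: tl_map_def)
qed (simp add: tl_map_def isolate_NC assms)

text \<open>The bound \<open>2*n-2\<close> keeps the odd case away from the merge of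
  \<open>n\<close> and \<open>1\<close>: that merge has index \<open>2*n-1\<close> and only occurs
  as the image of isolating \<open>n\<close>.\<close>

lemma kreweras_tl_map:
  assumes P: "P \<in> NC n" and i: "i \<in> {1..2*n-2}"
  shows "kreweras n (tl_map n i P) = tl_map n (Suc i) (kreweras n P)"
proof (cases "odd i")
  case True
  then obtain k where k: "i = 2 * k + 1" by (auto elim: oddE)
  then have "1 \<le> Suc k" "Suc k < n" using i by auto
  then show ?thesis using kreweras_merge [OF P, of "Suc k"] by (simp add: tl_map_def k cyc_succ_def)
next
  case False
  then obtain k where k: "i = 2 * k" by auto
  then have "Suc k \<in> {1..n}" using i by auto
  then show ?thesis using kreweras_isolate [OF P, of "Suc k"] by (simp add: tl_map_def k)
qed

lemma tl_map_idem:
  assumes P: "P \<in> NC n" and i: "i \<in> {1..2*n-1}"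
  shows "tl_map n i (tl_map n i P) = tl_map n i P"
proof (cases "odd i")
  case True
  have a: "Suc i div 2 \<in> {1..n}" using i by auto
  show ?thesis
    using same_block_merge_ends [OF NC_partition [OF P] a cyc_succ_in [OF a]]
    unfolding tl_map_def if_P [OF True]
      merge_fixed_iff [OF partition_on_merge [OF NC_partition [OF P]] a cyc_succ_in [OF a]] .
next
  case False
  have c: "Suc (i div 2) \<in> {1..n}" using i False by auto
  show ?thesis
    unfolding tl_map_def if_not_P [OF False]
      isolate_fixed_iff [OF partition_on_isolate [OF NC_partition [OF P]] c]
    by (intro allI impI isolated_isolate [OF NC_partition [OF P]])
qed

text \<open>Operators with consecutive indices share the point \<open>c\<close>. The equalities give
  the partitions in the three-fold products; the inequalities say that no factor \<tau> arises after
  the first operator.\<close>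

lemma merge_isolate_braid:
  assumes P: "partition_on {1..n} P" and ab: "a \<in> {1..n}" "b \<in> {1..n}" "a \<noteq> b" and c: "c = a \<or> c = b"
  shows "merge_blocks n a b (isolate n c (merge_blocks n a b P)) = merge_blocks n a b P"
    "isolate n c (merge_blocks n a b P) \<noteq> merge_blocks n a b P"
    "isolate n c (merge_blocks n a b (isolate n c P)) = isolate n c P"
    "merge_blocks n a b (isolate n c P) \<noteq> isolate n c P"
proof -
  \<comment> \<open>Here \<open>d\<close> is the other merged point; merging is symmetric in its two
    points, so the isolated one may be listed first.\<close>
  obtain d where d: "merge_blocks n a b = merge_blocks n c d" "c \<in> {1..n}" "d \<in> {1..n}" "c \<noteq> d"
  proof (cases "c = a")
    case True
    then show thesis using that [of b] ab by simp
  next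
    case False
    then show thesis
      using that [of a] ab c merge_commute_args [of n a b] by (simp add: fun_eq_iff)
  qed
  note M = partition_on_merge [OF P, of c d] and I = partition_on_isolate [OF P, of c]
  note cd = same_block_merge_ends [OF P d(2,3)]
  show "merge_blocks n a b (isolate n c (merge_blocks n a b P)) = merge_blocks n a b P"
    unfolding d(1) by (rule merge_isolate_same_block [OF M cd d(4)])
  show "isolate n c (merge_blocks n a b P) \<noteq> merge_blocks n a b P"
    unfolding d(1) isolate_fixed_iff [OF M d(2)] using cd d(4) by blast
  show "isolate n c (merge_blocks n a b (isolate n c P)) = isolate n c P"
    unfolding d(1) by (rule isolate_merge_isolated [OF I isolated_isolate [OF P]])
  show "merge_blocks n a b (isolate n c P) \<noteq> isolate n c P"
    unfolding d(1) merge_fixed_iff [OF I d(2,3)] using isolated_isolate [OF P] d(4) by metis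
qed

lemma tl_map_braid:
  assumes P: "P \<in> NC n" and i: "i \<in> {1..2*n-2}"
  shows "tl_map n i (tl_map n (Suc i) (tl_map n i P)) = tl_map n i P"
    "tl_map n (Suc i) (tl_map n i P) \<noteq> tl_map n i P"
    "tl_map n (Suc i) (tl_map n i (tl_map n (Suc i) P)) = tl_map n (Suc i) P"
    "tl_map n i (tl_map n (Suc i) P) \<noteq> tl_map n (Suc i) P"
proof -
  obtain a c where a: "a \<in> {1..n}" "a \<noteq> cyc_succ n a" "c = a \<or> c = cyc_succ n a"
    and h: "tl_map n i = merge_blocks n a (cyc_succ n a) \<and> tl_map n (Suc i) = isolate n c \<or>
      tl_map n i = isolate n c \<and> tl_map n (Suc i) = merge_blocks n a (cyc_succ n a)"
  proof (cases "odd i")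
    case True
    then obtain k where k: "i = 2 * k + 1" by (auto elim: oddE)
    then show thesis using i by (intro that [of "Suc k" "Suc (Suc k)"]) (auto simp: tl_map_def cyc_succ_def)
  next
    case False
    then obtain k where k: "i = 2 * k" by auto
    then show thesis using i by (intro that [of "Suc k" "Suc k"]) (auto simp: tl_map_def cyc_succ_def)
  qed
  note * = merge_isolate_braid [OF NC_partition [OF P] a(1) cyc_succ_in [OF a(1)] a(2,3)]
  from h * show "tl_map n i (tl_map n (Suc i) (tl_map n i P)) = tl_map n i P"
    "tl_map n (Suc i) (tl_map n i P) \<noteq> tl_map n i P"
    "tl_map n (Suc i) (tl_map n i (tl_map n (Suc i) P)) = tl_map n (Suc i) P"
    "tl_map n i (tl_map n (Suc i) P) \<noteq> tl_map n (Suc i) P"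
    by (elim disjE conjE; simp only: not_False_eq_True)+
qed

text \<open>The exchange property in the second part makes the two products pick up the same power of \<open>\<tau>\<close>.\<close>

lemma tl_map_commute:
  assumes P: "P \<in> NC n" and ij: "i \<in> {1..2*n-1}" "j \<in> {1..2*n-1}" "\<bar>int i - int j\<bar> > 1"
  shows "tl_map n i (tl_map n j P) = tl_map n j (tl_map n i P) \<and>
    (tl_map n i P \<noteq> P \<longrightarrow> tl_map n i (tl_map n j P) = tl_map n j P \<longrightarrow>
      tl_map n j (tl_map n i P) = tl_map n i P)"
proof -
  note Pp = NC_partition [OF P]
  have odd: "Suc k div 2 \<in> {1..n}" "cyc_succ n (Suc k div 2) \<in> {1..n}" if "k \<in> {1..2*n-1}" for k
    using that by (auto simp: cyc_succ_def)
  have even: "Suc (k div 2) \<in> {1..n}" if "k \<in> {1..2*n-1}" "even k" for k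
    using that by auto
  \<comment> \<open>For \<open>k = 2 * p + 1\<close> and \<open>m = 2 * q\<close>, the isolated
    point \<open>q + 1\<close> meets \<open>p + 1\<close> or \<open>p + 2\<close> only if
    \<open>m\<close> is a neighbour of \<open>k\<close>. In the wrap-around case the second merged
    point is \<open>1\<close>, which would be isolated at index \<open>0\<close>; this is where
    \<open>m \<ge> 1\<close> enters.\<close>
  have mixed: "Suc (m div 2) \<noteq> Suc k div 2" "Suc (m div 2) \<noteq> cyc_succ n (Suc k div 2)"
    if "odd k" "even m" "\<bar>int k - int m\<bar> > 1" "m \<in> {1..2*n-1}" for k m
  proof -
    obtain p where p: "k = 2 * p + 1" using \<open>odd k\<close> by (rule oddE)
    obtain q where q: "m = 2 * q" using \<open>even m\<close> by (rule evenE)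
    show "Suc (m div 2) \<noteq> Suc k div 2" "Suc (m div 2) \<noteq> cyc_succ n (Suc k div 2)"
      using that(3,4) by (auto simp: p q cyc_succ_def)
  qed
  consider (mm) "odd i" "odd j" | (ii) "even i" "even j" | (mi) "odd i" "even j" | (im) "even i" "odd j"
    by blast
  then show ?thesis
  proof cases
    case mm
    note o = odd [OF ij(1)] odd [OF ij(2)]
    have t: "tl_map n i = merge_blocks n (Suc i div 2) (cyc_succ n (Suc i div 2))"
      "tl_map n j = merge_blocks n (Suc j div 2) (cyc_succ n (Suc j div 2))"
      using mm by (simp_all add: tl_map_def)
    show ?thesis
      unfolding t merge_fixed_iff [OF Pp o(1,2)] merge_fixed_iff [OF partition_on_merge [OF Pp] o(1,2)]
        merge_fixed_iff [OF partition_on_merge [OF Pp] o(3,4)]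
      using merge_commute [OF Pp o] merge_exchange [OF Pp o] by blast
  next
    case ii
    note e = even [OF ij(1) ii(1)] even [OF ij(2) ii(2)]
    have t: "tl_map n i = isolate n (Suc (i div 2))" "tl_map n j = isolate n (Suc (j div 2))"
      using ii by (simp_all add: tl_map_def)
    show ?thesis
      unfolding t using isolate_commute [OF Pp] isolate_exchange [OF Pp e] by blast
  next
    case mi
    note o = odd [OF ij(1)] and m = mixed [OF mi ij(3,2)]
    have t: "tl_map n i = merge_blocks n (Suc i div 2) (cyc_succ n (Suc i div 2))"
      "tl_map n j = isolate n (Suc (j div 2))"
      using mi by (simp_all add: tl_map_def)
    show ?thesis
      unfolding t merge_fixed_isolate_iff [OF Pp o m]
      using merge_isolate_commute [OF Pp o m] by blast
  next
    case im
    have ji: "\<bar>int j - int i\<bar> > 1" using ij(3) by linarith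
    note o = odd [OF ij(2)] and m = mixed [OF im(2,1) ji ij(1)]
    have t: "tl_map n j = merge_blocks n (Suc j div 2) (cyc_succ n (Suc j div 2))"
      "tl_map n i = isolate n (Suc (i div 2))"
      using im by (simp_all add: tl_map_def)
    show ?thesis
      unfolding t isolate_fixed_merge_iff [OF Pp even [OF ij(1) im(1)] m]
      using merge_isolate_commute [OF Pp o m] by metis
  qed
qed

section \<open>The operators on the module\<close>

lemma lookup_lsmult: "Poly_Mapping.lookup (lsmult c v) k = c * Poly_Mapping.lookup v k"
  by (simp add: lsmult_def Poly_Mapping.map.rep_eq when_def)

lemma lsmult_add_right: "lsmult c (v + w) = lsmult c v + lsmult c w"
  by (rule poly_mapping_eqI) (simp add: lookup_lsmult lookup_add algebra_simps)

lemma lsmult_add_left: "lsmult (c + d) v = lsmult c v + lsmult d v"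
  by (rule poly_mapping_eqI) (simp add: lookup_lsmult lookup_add algebra_simps)

lemma lsmult_lsmult: "lsmult c (lsmult d v) = lsmult (c * d) v"
  by (rule poly_mapping_eqI) (simp add: lookup_lsmult algebra_simps)

lemma lsmult_one [simp]: "lsmult 1 v = v"
  by (rule poly_mapping_eqI) (simp add: lookup_lsmult)

lemma lsmult_zero_left [simp]: "lsmult 0 v = 0"
  by (rule poly_mapping_eqI) (simp add: lookup_lsmult)

lemma lsmult_zero_right [simp]: "lsmult c 0 = 0"
  by (rule poly_mapping_eqI) (simp add: lookup_lsmult)

lemma lsmult_sum: "lsmult c (sum f S) = (\<Sum>x\<in>S. lsmult c (f x))"
  by (induction S rule: infinite_finite_induct) (simp_all add: lsmult_add_right)

lemma keys_lsmult: "Poly_Mapping.keys (lsmult c v) \<subseteq> Poly_Mapping.keys v"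
  by (auto simp: in_keys_iff lookup_lsmult)

text \<open>Cancellation can shrink the support of a sum or a multiple, so linearity is proved by
  summing over one finite set containing all supports involved.\<close>

lemma lin_extend_superset:
  assumes "finite S" "Poly_Mapping.keys v \<subseteq> S"
  shows "lin_extend g v = (\<Sum>b\<in>S. lsmult (Poly_Mapping.lookup v b) (g b))"
  unfolding lin_extend_def
  by (rule sum.mono_neutral_left) (use assms in \<open>auto simp: in_keys_iff\<close>)

lemma lin_extend_add: "lin_extend g (v + w) = lin_extend g v + lin_extend g w"
proof -
  let ?S = "Poly_Mapping.keys v \<union> Poly_Mapping.keys w"
  have "finite ?S" "Poly_Mapping.keys (v + w) \<subseteq> ?S" by (simp_all only: finite_Un finite_keys keys_add simp_thms)
  then show ?thesis
    by (simp add: lin_extend_superset [of ?S] lookup_add lsmult_add_left sum.distrib)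
qed

lemma lin_extend_lsmult: "lin_extend g (lsmult c v) = lsmult c (lin_extend g v)"
  by (simp add: lin_extend_superset [OF finite_keys keys_lsmult] lin_extend_def [of g v] lookup_lsmult
      lsmult_sum lsmult_lsmult)

lemma lin_extend_zero [simp]: "lin_extend g 0 = 0"
  by (simp add: lin_extend_def)

lemma lin_extend_minus: "lin_extend g (v - w) = lin_extend g v - lin_extend g w"
  using lin_extend_add [of g "v - w" w] by (simp add: algebra_simps)

lemma lin_extend_sum: "lin_extend g (sum f S) = (\<Sum>x\<in>S. lin_extend g (f x))"
  by (induction S rule: infinite_finite_induct) (simp_all add: lin_extend_add)

lemma lin_extend_basis_vec [simp]: "lin_extend g (basis_vec b) = g b"
  by (simp add: lin_extend_def basis_vec_def)

lemma lin_extend_lin_extend: "lin_extend g (lin_extend h v) = lin_extend (\<lambda>b. lin_extend g (h b)) v"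
  by (simp add: lin_extend_def [of h] lin_extend_def [of "\<lambda>b. lin_extend g (h b)"] lin_extend_sum
      lin_extend_lsmult)

lemma lsmult_lin_extend: "lsmult c (lin_extend g v) = lin_extend (\<lambda>b. lsmult c (g b)) v"
  by (simp add: lin_extend_def lsmult_sum lsmult_lsmult mult.commute)

lemma lin_extend_cong:
  "(\<And>b. b \<in> Poly_Mapping.keys v \<Longrightarrow> g b = h b) \<Longrightarrow> lin_extend g v = lin_extend h v"
  by (simp add: lin_extend_def)

lemma lin_extend_basis_vec_id [simp]: "lin_extend basis_vec v = v"
proof (rule poly_mapping_eqI)
  fix k
  have "Poly_Mapping.lookup (lin_extend basis_vec v) k =
      (\<Sum>b\<in>Poly_Mapping.keys v. if b = k then Poly_Mapping.lookup v b else 0)"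
    by (simp add: lin_extend_def lookup_sum lookup_lsmult basis_vec_def lookup_single when_def
        if_distrib cong: if_cong)
  then show "Poly_Mapping.lookup (lin_extend basis_vec v) k = Poly_Mapping.lookup v k"
    by (simp add: sum.delta in_keys_iff)
qed

lemma V_add: "v \<in> V n \<Longrightarrow> w \<in> V n \<Longrightarrow> v + w \<in> V n"
  using keys_add [of v w] by (auto simp: V_def)

lemma V_zero [simp]: "0 \<in> V n"
  by (simp add: V_def)

lemma V_lsmult: "v \<in> V n \<Longrightarrow> lsmult c v \<in> V n"
  using keys_lsmult [of c v] by (auto simp: V_def)

lemma V_sum: "(\<And>x. x \<in> S \<Longrightarrow> f x \<in> V n) \<Longrightarrow> sum f S \<in> V n"
  by (induction S rule: infinite_finite_induct) (auto intro: V_add)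

lemma V_basis_vec: "P \<in> NC n \<Longrightarrow> basis_vec P \<in> V n"
  by (simp add: V_def basis_vec_def)

lemma V_lin_extend:
  "(\<And>b. b \<in> Poly_Mapping.keys v \<Longrightarrow> g b \<in> V n) \<Longrightarrow> lin_extend g v \<in> V n"
  unfolding lin_extend_def by (intro V_sum V_lsmult)

lemma lin_extend_V_cong:
  "v \<in> V n \<Longrightarrow> (\<And>P. P \<in> NC n \<Longrightarrow> g P = h P) \<Longrightarrow> lin_extend g v = lin_extend h v"
  by (rule lin_extend_cong) (auto simp: V_def)

text \<open>\<open>rho_inv\<close> merely chooses a preimage in \<open>V n\<close>; this lemma makes
  it the inverse of \<rho> there. The witness \<open>r\<close> extends the inverse of the Kreweras
  map linearly.\<close>

lemma rho_bij: "bij_betw (rho n) (V n) (V n)"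
proof -
  define k where "k = inv_into (NC n) (kreweras n)"
  have k: "k (kreweras n P) = P" if "P \<in> NC n" for P
    using that inj_on_kreweras by (simp add: k_def)
  have k2: "k P \<in> NC n \<and> kreweras n (k P) = P" if "P \<in> NC n" for P
    using that kreweras_image_NC [of n] unfolding k_def
    by (metis f_inv_into_f inv_into_into)
  define r where "r = lin_extend (\<lambda>P. basis_vec (k P))"
  show ?thesis
  proof (rule bij_betw_byWitness [of _ r])
    show "\<forall>v\<in>V n. r (rho n v) = v"
    proof
      fix v assume "v \<in> V n"
      then have "lin_extend (\<lambda>P. basis_vec (k (kreweras n P))) v = lin_extend basis_vec v"
        by (rule lin_extend_V_cong) (simp add: k)
      then show "r (rho n v) = v" by (simp add: r_def rho_def lin_extend_lin_extend)
    qed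
    show "\<forall>v\<in>V n. rho n (r v) = v"
    proof
      fix v assume "v \<in> V n"
      then have "lin_extend (\<lambda>P. basis_vec (kreweras n (k P))) v = lin_extend basis_vec v"
        by (rule lin_extend_V_cong) (simp add: k2)
      then show "rho n (r v) = v" by (simp add: r_def rho_def lin_extend_lin_extend)
    qed
    show "rho n ` V n \<subseteq> V n"
      unfolding rho_def
      by (intro image_subsetI V_lin_extend V_basis_vec kreweras_NC) (auto simp: V_def)
    show "r ` V n \<subseteq> V n"
      unfolding r_def
      by (intro image_subsetI V_lin_extend V_basis_vec) (auto simp: V_def k2 subset_iff)
  qed
qed

section \<open>The operators in closed form, as weighted maps on partitions\<close>

definition tl_weight :: "nat \<Rightarrow> nat \<Rightarrow> nat set set \<Rightarrow> laurent" where
  "tl_weight n i P = (if tl_map n i P = P then tau else 1)"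

text \<open>A description of \<open>F n i\<close> free of conjugation and of \<open>rho_inv\<close>.
  The two agree on \<open>V n\<close> for indices from \<open>1\<close> to \<open>2*n-1\<close>, and
  all relations are proved for this form.\<close>

definition tl_op :: "nat \<Rightarrow> nat \<Rightarrow> (nat set set \<Rightarrow>\<^sub>0 laurent) \<Rightarrow> (nat set set \<Rightarrow>\<^sub>0 laurent)" where
  "tl_op n i = lin_extend (\<lambda>P. lsmult (tl_weight n i P) (basis_vec (tl_map n i P)))"

lemma block_of_eq:
  assumes "partition_on {1..n} P" "B \<in> P" "i \<in> B"
  shows "block_of P i = B"
  unfolding block_of_def using assms block_unique [OF assms(1)] by (intro the_equality) auto

lemma block_of_same_block:
  assumes P: "partition_on {1..n} P" and i: "i \<in> {1..n}"
  shows "block_of P i \<in> P" "x \<in> block_of P i \<longleftrightarrow> same_block P x i"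
proof -
  obtain B where B: "B \<in> P" "i \<in> B" using partition_onD1 [OF P] i by blast
  note [simp] = block_of_eq [OF P B]
  show "block_of P i \<in> P" using B by simp
  show "x \<in> block_of P i \<longleftrightarrow> same_block P x i"
    using B block_unique [OF P] by (auto simp: same_block_def)
qed

lemma block_of_eq_iff:
  assumes P: "partition_on {1..n} P" and ij: "i \<in> {1..n}" "j \<in> {1..n}"
  shows "block_of P i = block_of P j \<longleftrightarrow> same_block P i j"
proof
  assume "block_of P i = block_of P j"
  then show "same_block P i j"
    using block_of_same_block(2) [OF P ij(1), of i] block_of_same_block(2) [OF P ij(2), of i]
      same_block_refl [OF P ij(1)] by simp
next
  assume "same_block P i j"
  then obtain B where "B \<in> P" "i \<in> B" "j \<in> B" by (auto simp: same_block_def)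
  then show "block_of P i = block_of P j" by (simp add: block_of_eq [OF P])
qed

lemma merge12_eq_merge_blocks:
  assumes P: "partition_on {1..n} P" and n: "2 \<le> n"
  shows "merge12 P = merge_blocks n 1 2 P"
proof -
  have n12: "1 \<in> {1..n}" "2 \<in> {1..n}" using n by auto
  let ?b1 = "block_of P 1" and ?b2 = "block_of P 2"
  note b = block_of_same_block [OF P n12(1)] block_of_same_block [OF P n12(2)]
  have part: "partition_on {1..n} (merge12 P)"
  proof (rule partition_onI)
    show "\<Union>(merge12 P) = {1..n}"
      using partition_onD1 [OF P] b(1,3) by (auto simp: merge12_def)
    show "{} \<notin> merge12 P"
      using partition_onD3 [OF P] b(1) by (auto simp: merge12_def)
    show "disjnt p q" if pq: "p \<in> merge12 P" "q \<in> merge12 P" "p \<noteq> q" for p q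
    proof -
      have *: "disjnt B C" if "B \<in> P" "C \<in> P" "B \<noteq> C" for B C
        using that block_unique [OF P] by (auto simp: disjnt_iff)
      have U: "disjnt B (?b1 \<union> ?b2)" if "B \<in> P - {?b1, ?b2}" for B
        using * [of B ?b1] * [of B ?b2] that b(1,3) by (simp add: disjnt_Un2)
      consider "p = ?b1 \<union> ?b2" "q \<in> P - {?b1, ?b2}" | "q = ?b1 \<union> ?b2" "p \<in> P - {?b1, ?b2}"
        | "p \<in> P" "q \<in> P"
        using pq unfolding merge12_def by blast
      then show ?thesis
      proof cases
        case 1
        then show ?thesis using U disjnt_sym by blast
      next
        case 2
        then show ?thesis using U by blast
      next
        case 3
        then show ?thesis using * pq(3) by blast
      qed
    qed
  qed
  show ?thesis
  proof (rule partition_eqI [OF part partition_on_merge [OF P]])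
    fix x y assume xy: "x \<in> {1..n}" "y \<in> {1..n}"
    have "same_block (merge12 P) x y \<longleftrightarrow>
        (x \<in> ?b1 \<or> x \<in> ?b2) \<and> (y \<in> ?b1 \<or> y \<in> ?b2) \<or> (\<exists>B\<in>P - {?b1, ?b2}. x \<in> B \<and> y \<in> B)"
      by (simp add: same_block_def merge12_def)
    also have "\<dots> \<longleftrightarrow> (x \<in> ?b1 \<or> x \<in> ?b2) \<and> (y \<in> ?b1 \<or> y \<in> ?b2) \<or> same_block P x y"
    proof -
      have "(x \<in> ?b1 \<or> x \<in> ?b2) \<and> (y \<in> ?b1 \<or> y \<in> ?b2) \<or> (\<exists>B\<in>P - {?b1, ?b2}. x \<in> B \<and> y \<in> B)"
        if "B \<in> P" "x \<in> B" "y \<in> B" for B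
        using that by (cases "B = ?b1 \<or> B = ?b2") auto
      then show ?thesis unfolding same_block_def by blast
    qed
    also have "\<dots> \<longleftrightarrow> same_block (merge_blocks n 1 2 P) x y"
      unfolding same_block_merge [OF P] b(2,4) using xy by blast
    finally show "same_block (merge12 P) x y \<longleftrightarrow> same_block (merge_blocks n 1 2 P) x y" .
  qed
qed

lemma f1_eq_tl_op:
  assumes n: "2 \<le> n" and v: "v \<in> V n"
  shows "f1 v = tl_op n 1 v"
  unfolding f1_def tl_op_def using v
proof (rule lin_extend_V_cong)
  fix P assume "P \<in> NC n"
  note P = NC_partition [OF this]
  have n12: "1 \<in> {1..n}" "2 \<in> {1..n}" using n by auto
  have t: "tl_map n 1 = merge_blocks n 1 2" using n by (simp add: tl_map_def cyc_succ_def numeral_2_eq_2)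
  have "tl_map n 1 P = P \<longleftrightarrow> block_of P 1 = block_of P 2"
    unfolding t merge_fixed_iff [OF P n12] block_of_eq_iff [OF P n12] ..
  then show "(if block_of P 1 = block_of P 2 then lsmult tau (basis_vec P) else basis_vec (merge12 P)) =
      lsmult (tl_weight n 1 P) (basis_vec (tl_map n 1 P))"
    by (cases "tl_map n 1 P = P")
      (simp_all add: tl_weight_def merge12_eq_merge_blocks [OF P n, folded t] del: One_nat_def)
qed

lemma tl_op_V: "v \<in> V n \<Longrightarrow> i \<in> {1..2*n-1} \<Longrightarrow> tl_op n i v \<in> V n"
  unfolding tl_op_def
  by (intro V_lin_extend V_lsmult V_basis_vec tl_map_NC) (auto simp: V_def)

text \<open>The weights on both sides match because the Kreweras map is injective: it carries fixed
  partitions of one map to fixed partitions of the next, and only those.\<close>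

lemma rho_tl_op:
  assumes v: "v \<in> V n" and i: "i \<in> {1..2*n-2}"
  shows "rho n (tl_op n i v) = tl_op n (Suc i) (rho n v)"
  unfolding rho_def tl_op_def lin_extend_lin_extend lin_extend_lsmult lin_extend_basis_vec using v
proof (rule lin_extend_V_cong)
  fix P assume P: "P \<in> NC n"
  have "i \<in> {1..2*n-1}" using i by auto
  then have "kreweras n (tl_map n i P) = kreweras n P \<longleftrightarrow> tl_map n i P = P"
    using inj_on_eq_iff [OF inj_on_kreweras] P tl_map_NC by blast
  then show "lsmult (tl_weight n i P) (basis_vec (kreweras n (tl_map n i P))) =
      lsmult (tl_weight n (Suc i) (kreweras n P)) (basis_vec (tl_map n (Suc i) (kreweras n P)))"
    by (simp add: tl_weight_def kreweras_tl_map [OF P i, symmetric])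
qed

lemma F_eq_tl_op:
  assumes n: "2 \<le> n" and v: "v \<in> V n" and i: "i \<in> {1..2*n-1}"
  shows "F n i v = tl_op n i v"
  using i v
proof (induction i arbitrary: v rule: less_induct)
  case (less i)
  show ?case
  proof (cases "i = 1")
    case True
    then show ?thesis using f1_eq_tl_op [OF n less.prems(2)] by simp
  next
    case False
    then obtain k where k: "i = Suc (Suc k)" using less.prems(1) by (metis One_nat_def atLeastAtMost_iff not0_implies_Suc not_one_le_zero)
    have kin: "Suc k \<in> {1..2*n-2}" "Suc k \<in> {1..2*n-1}" using less.prems(1) k by auto
    define u where "u = rho_inv n v"
    have u: "u \<in> V n" "rho n u = v"
      using rho_bij [of n] less.prems(2) unfolding u_def rho_inv_def bij_betw_def
      by (metis inv_into_into, metis f_inv_into_f)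
    have "F n i v = rho n (F n (Suc k) u)" by (simp add: k u_def)
    also have "\<dots> = rho n (tl_op n (Suc k) u)"
      using less.IH [OF _ kin(2) u(1)] k by simp
    also have "\<dots> = tl_op n i v"
      using rho_tl_op [OF u(1) kin(1)] u(2) k by simp
    finally show ?thesis .
  qed
qed

section \<open>The Temperley--Lieb relations\<close>

lemma tl_op_basis_vec: "tl_op n i (basis_vec P) = lsmult (tl_weight n i P) (basis_vec (tl_map n i P))"
  by (simp add: tl_op_def)

lemma tl_op_add: "tl_op n i (v + w) = tl_op n i v + tl_op n i w"
  by (simp add: tl_op_def lin_extend_add)

lemma tl_op_lsmult: "tl_op n i (lsmult c v) = lsmult c (tl_op n i v)"
  by (simp add: tl_op_def lin_extend_lsmult)

text \<open>Linearity is expressed by the two equations with \<open>lin_extend\<close>, because for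
  composites of \<open>tl_op\<close> these are closed by rewriting nested linear extensions.\<close>

lemma linear_eq_on_V:
  assumes "v \<in> V n" "S v = lin_extend (\<lambda>P. S (basis_vec P)) v" "T v = lin_extend (\<lambda>P. T (basis_vec P)) v"
    and "\<And>P. P \<in> NC n \<Longrightarrow> S (basis_vec P) = T (basis_vec P)"
  shows "S v = T v"
  using lin_extend_V_cong [OF assms(1,4)] assms(2,3) by simp

lemma tl_op_square:
  assumes v: "v \<in> V n" and i: "i \<in> {1..2*n-1}"
  shows "tl_op n i (tl_op n i v) = lsmult tau (tl_op n i v)"
proof (rule linear_eq_on_V [OF v])
  fix P assume P: "P \<in> NC n"
  show "tl_op n i (tl_op n i (basis_vec P)) = lsmult tau (tl_op n i (basis_vec P))"
    by (simp add: tl_op_basis_vec tl_op_lsmult tl_map_idem [OF P i] tl_weight_def [of n i "tl_map n i P"]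
        lsmult_lsmult mult.commute)
qed (simp_all add: tl_op_def lin_extend_lin_extend lsmult_lin_extend)

text \<open>The first operator contributes the same weight on both sides. The second moves the
  partition, and the third moves it back, so by the inequalities in \<open>tl_map_braid\<close> both
  have weight \<open>1\<close>.\<close>

lemma tl_op_braid:
  assumes v: "v \<in> V n" and i: "i \<in> {1..2*n-2}"
  shows "tl_op n i (tl_op n (Suc i) (tl_op n i v)) = tl_op n i v"
    "tl_op n (Suc i) (tl_op n i (tl_op n (Suc i) v)) = tl_op n (Suc i) v"
proof -
  have *: "tl_op n j (tl_op n k (tl_op n j v)) = tl_op n j v"
    if "\<And>P. P \<in> NC n \<Longrightarrow> tl_map n j (tl_map n k (tl_map n j P)) = tl_map n j P"
      "\<And>P. P \<in> NC n \<Longrightarrow> tl_map n k (tl_map n j P) \<noteq> tl_map n j P" for j k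
  proof (rule linear_eq_on_V [OF v])
    fix P assume P: "P \<in> NC n"
    have "tl_weight n k (tl_map n j P) = 1" "tl_weight n j (tl_map n k (tl_map n j P)) = 1"
      using that [OF P] by (simp_all add: tl_weight_def)
    then show "tl_op n j (tl_op n k (tl_op n j (basis_vec P))) = tl_op n j (basis_vec P)"
      by (simp add: tl_op_basis_vec tl_op_lsmult that(1) [OF P])
  qed (simp_all add: tl_op_def lin_extend_lin_extend)
  show "tl_op n i (tl_op n (Suc i) (tl_op n i v)) = tl_op n i v"
    using tl_map_braid(1,2) [OF _ i] by (rule *)
  show "tl_op n (Suc i) (tl_op n i (tl_op n (Suc i) v)) = tl_op n (Suc i) v"
    using tl_map_braid(3,4) [OF _ i] by (rule *)
qed

lemma tl_op_commute:
  assumes v: "v \<in> V n" and ij: "i \<in> {1..2*n-1}" "j \<in> {1..2*n-1}" "\<bar>int i - int j\<bar> > 1"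
  shows "tl_op n i (tl_op n j v) = tl_op n j (tl_op n i v)"
proof (rule linear_eq_on_V [OF v])
  fix P assume P: "P \<in> NC n"
  have ji: "\<bar>int j - int i\<bar> > 1" using ij(3) by linarith
  note c = tl_map_commute [OF P ij] tl_map_commute [OF P ij(2,1) ji]
  \<comment> \<open>If one map fixes \<open>P\<close>, commutation makes it fix the image under the
    other, and the same two weights appear. Otherwise both first weights are \<open>1\<close>, and
    the exchange property, used in both directions, equates the second weights.\<close>
  have "tl_weight n j P * tl_weight n i (tl_map n j P) = tl_weight n i P * tl_weight n j (tl_map n i P)"
  proof (cases "tl_map n i P = P \<or> tl_map n j P = P")
    case True
    then show ?thesis using c by (auto simp: tl_weight_def)
  next
    case False
    then have "tl_map n i (tl_map n j P) = tl_map n j P \<longleftrightarrow> tl_map n j (tl_map n i P) = tl_map n i P"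
      using c by blast
    then show ?thesis using False by (simp add: tl_weight_def)
  qed
  then show "tl_op n i (tl_op n j (basis_vec P)) = tl_op n j (tl_op n i (basis_vec P))"
    using c by (simp add: tl_op_basis_vec tl_op_lsmult lsmult_lsmult)
qed (simp_all add: tl_op_def lin_extend_lin_extend)

section \<open>The action of the Temperley--Lieb algebra\<close>

lemma letters_add: "letters (u + w) = letters u @ letters w"
  by (simp add: plus_free_monoid_def)

lemma letters_zero: "letters 0 = []"
  by (simp add: zero_free_monoid_def)

lemma lsmult_eq_mult: "lsmult c p = Poly_Mapping.single 0 c * p"
  for p :: "'a::monoid_add \<Rightarrow>\<^sub>0 laurent"
  unfolding lsmult_def by (rule mult_map_scale_conv_mult)

lemma lsmult_mult_left: "lsmult c p * q = lsmult c (p * q)"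
  for p q :: "'a::monoid_add \<Rightarrow>\<^sub>0 laurent"
  by (simp add: lsmult_eq_mult mult.assoc)

lemma basis_vec_mult_lsmult: "basis_vec u * lsmult c q = lsmult c (basis_vec u * q)"
  for q :: "'a::monoid_add \<Rightarrow>\<^sub>0 laurent"
  by (simp add: lsmult_eq_mult basis_vec_def mult.assoc [symmetric] mult_single)

lemma basis_vec_mult: "basis_vec u * basis_vec w = basis_vec (u + w)"
  by (simp add: basis_vec_def mult_single)

text \<open>Convolution rewritten as a linear extension in the left factor, so that multiplicativity
  of the action can be checked word by word.\<close>

lemma mult_eq_lin_extend: "p * q = lin_extend (\<lambda>u. basis_vec u * q) p"
  for p q :: "'a::monoid_add \<Rightarrow>\<^sub>0 laurent"
proof -
  have "p * q = lin_extend basis_vec p * q" by simp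
  also have "\<dots> = lin_extend (\<lambda>u. basis_vec u * q) p"
    unfolding lin_extend_def by (simp add: sum_distrib_right lsmult_mult_left)
  finally show ?thesis .
qed

lemma basis_vec_mult_eq_lin_extend: "basis_vec u * q = lin_extend (\<lambda>w. basis_vec (u + w)) q"
  for q :: "'a::monoid_add \<Rightarrow>\<^sub>0 laurent"
proof -
  have "basis_vec u * q = basis_vec u * lin_extend basis_vec q" by simp
  also have "\<dots> = lin_extend (\<lambda>w. basis_vec (u + w)) q"
    unfolding lin_extend_def by (simp add: sum_distrib_left basis_vec_mult_lsmult basis_vec_mult)
  finally show ?thesis .
qed

lemma lin_extend_fun_add: "lin_extend (\<lambda>b. g b + h b) v = lin_extend g v + lin_extend h v"
  by (simp add: lin_extend_def lsmult_add_right sum.distrib)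

lemma ring_free_algebra: "ring (free_algebra X)"
proof (rule ringI)
  have uminus: "Poly_Mapping.keys (- p) = Poly_Mapping.keys p" for p :: free_alg
    by (auto simp: in_keys_iff)
  show "abelian_group (free_algebra X)"
  proof (rule abelian_groupI)
    fix p q :: free_alg assume "p \<in> carrier (free_algebra X)" "q \<in> carrier (free_algebra X)"
    then show "p \<oplus>\<^bsub>free_algebra X\<^esub> q \<in> carrier (free_algebra X)"
      using keys_add [of p q] by (auto simp: free_algebra_def)
  next
    fix p :: free_alg assume "p \<in> carrier (free_algebra X)"
    then show "\<exists>q\<in>carrier (free_algebra X). q \<oplus>\<^bsub>free_algebra X\<^esub> p = \<zero>\<^bsub>free_algebra X\<^esub>"
      by (intro bexI [of _ "- p"]) (auto simp: free_algebra_def uminus)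
  qed (simp_all add: free_algebra_def add_ac)
  show "Group.monoid (free_algebra X)"
  proof (rule monoidI)
    fix p q :: free_alg assume "p \<in> carrier (free_algebra X)" "q \<in> carrier (free_algebra X)"
    then show "p \<otimes>\<^bsub>free_algebra X\<^esub> q \<in> carrier (free_algebra X)"
      using keys_mult [of p q] by (fastforce simp: free_algebra_def letters_add)
  qed (simp_all add: free_algebra_def mult.assoc letters_zero)
qed (simp_all add: free_algebra_def distrib_left distrib_right)

section \<open>The quotient of the free algebra by the relators\<close>

lemma gen_eq_basis_vec: "gen i = basis_vec (Word [i])"
  by (simp add: gen_def basis_vec_def)

lemma gen_in_carrier: "i \<in> X \<Longrightarrow> gen i \<in> carrier (free_algebra X)"
  by (simp add: gen_def free_algebra_def)

lemma carrier_lsmult: "p \<in> carrier (free_algebra X) \<Longrightarrow> lsmult c p \<in> carrier (free_algebra X)"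
  using keys_lsmult [of c p] by (auto simp: free_algebra_def)

lemma free_algebra_simps:
  "p \<otimes>\<^bsub>free_algebra X\<^esub> q = p * q" "p \<oplus>\<^bsub>free_algebra X\<^esub> q = p + q"
  "\<one>\<^bsub>free_algebra X\<^esub> = 1" "\<zero>\<^bsub>free_algebra X\<^esub> = 0"
  by (simp_all add: free_algebra_def)

lemma carrier_minus:
  assumes "p \<in> carrier (free_algebra X)" "q \<in> carrier (free_algebra X)"
  shows "p - q \<in> carrier (free_algebra X)"
  using assms unfolding free_algebra_def
  by (auto simp: in_keys_iff lookup_minus) (metis in_keys_iff subsetD)

lemma carrier_mult:
  "p \<in> carrier (free_algebra X) \<Longrightarrow> q \<in> carrier (free_algebra X) \<Longrightarrow> p * q \<in> carrier (free_algebra X)"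
  using monoid.m_closed [OF ring.is_monoid [OF ring_free_algebra]] by (simp add: free_algebra_simps)

lemma tl_relators_carrier: "tl_relators m \<subseteq> carrier (free_algebra {1..m-1})"
  unfolding tl_relators_def
  by (auto intro!: carrier_minus carrier_mult carrier_lsmult gen_in_carrier)

lemma ideal_tl_ideal: "ideal (tl_ideal m) (free_algebra {1..m-1})"
  unfolding tl_ideal_def by (rule ring.genideal_ideal [OF ring_free_algebra tl_relators_carrier])

lemma carrier_TL: "carrier (TL m) = tl_class m ` carrier (free_algebra {1..m-1})"
  by (auto simp: TL_def FactRing_def A_RCOSETS_def RCOSETS_def tl_class_def a_r_coset_def)

lemma tl_class_hom:
  assumes "p \<in> carrier (free_algebra {1..m-1})" "q \<in> carrier (free_algebra {1..m-1})"
  shows "tl_class m (p * q) = tl_class m p \<otimes>\<^bsub>TL m\<^esub> tl_class m q"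
    "tl_class m (p + q) = tl_class m p \<oplus>\<^bsub>TL m\<^esub> tl_class m q"
  using ring_hom_mult [OF ideal.rcos_ring_hom [OF ideal_tl_ideal] assms]
    ring_hom_add [OF ideal.rcos_ring_hom [OF ideal_tl_ideal] assms]
  by (simp_all add: tl_class_def TL_def free_algebra_simps)

lemma tl_class_one: "\<one>\<^bsub>TL m\<^esub> = tl_class m 1"
  using ring_hom_one [OF ideal.rcos_ring_hom [OF ideal_tl_ideal [of m]]]
  by (simp add: tl_class_def TL_def free_algebra_simps)

lemma tl_class_mem:
  assumes "p \<in> carrier (free_algebra {1..m-1})"
  shows "p \<in> tl_class m p"
proof -
  interpret ideal "tl_ideal m" "free_algebra {1..m-1}" by (rule ideal_tl_ideal)
  show ?thesis unfolding tl_class_def using assms by (rule a_rcos_self)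
qed

lemma tl_class_diff:
  assumes "q \<in> tl_class m p"
  shows "q - p \<in> tl_ideal m"
  using assms by (auto simp: tl_class_def a_r_coset_def r_coset_def free_algebra_simps free_algebra_def)

section \<open>The action of the free algebra and its descent to the quotient\<close>

definition word_op :: "nat \<Rightarrow> nat free_monoid \<Rightarrow> (nat set set \<Rightarrow>\<^sub>0 laurent) \<Rightarrow> (nat set set \<Rightarrow>\<^sub>0 laurent)" where
  "word_op n w v = foldr (tl_op n) (letters w) v"

definition alg_act :: "nat \<Rightarrow> free_alg \<Rightarrow> (nat set set \<Rightarrow>\<^sub>0 laurent) \<Rightarrow> (nat set set \<Rightarrow>\<^sub>0 laurent)" where
  "alg_act n p v = lin_extend (\<lambda>w. word_op n w v) p"

lemma word_op_plus: "word_op n (u + w) v = word_op n u (word_op n w v)"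
  by (simp add: word_op_def letters_add)

lemma word_op_add: "word_op n w (u + v) = word_op n w u + word_op n w v"
proof -
  have "foldr (tl_op n) l (u + v) = foldr (tl_op n) l u + foldr (tl_op n) l v" for l
    by (induction l) (simp_all add: tl_op_add)
  then show ?thesis by (simp add: word_op_def)
qed

lemma word_op_lsmult: "word_op n w (lsmult c v) = lsmult c (word_op n w v)"
proof -
  have "foldr (tl_op n) l (lsmult c v) = lsmult c (foldr (tl_op n) l v)" for l
    by (induction l) (simp_all add: tl_op_lsmult)
  then show ?thesis by (simp add: word_op_def)
qed

lemma word_op_zero: "word_op n w 0 = 0"
  using word_op_lsmult [of n w 0 0] by simp

lemma word_op_lin_extend: "word_op n w (lin_extend g p) = lin_extend (\<lambda>b. word_op n w (g b)) p"
proof -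
  have "word_op n w (sum f S) = (\<Sum>b\<in>S. word_op n w (f b))" for f :: "'a \<Rightarrow> _" and S
    by (induction S rule: infinite_finite_induct) (simp_all add: word_op_add word_op_zero)
  then show ?thesis by (simp add: lin_extend_def word_op_lsmult)
qed

lemma word_op_V:
  assumes "v \<in> V n" "set (letters w) \<subseteq> {1..2*n-1}"
  shows "word_op n w v \<in> V n"
proof -
  have "foldr (tl_op n) l v \<in> V n" if "set l \<subseteq> {1..2*n-1}" for l
    using that by (induction l) (use assms(1) in \<open>auto intro!: tl_op_V\<close>)
  then show ?thesis using assms(2) by (simp add: word_op_def)
qed

lemma alg_act_plus: "alg_act n (p + q) v = alg_act n p v + alg_act n q v"
  by (simp add: alg_act_def lin_extend_add)

lemma alg_act_minus: "alg_act n (p - q) v = alg_act n p v - alg_act n q v"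
  by (simp add: alg_act_def lin_extend_minus)

lemma alg_act_lsmult_left: "alg_act n (lsmult c p) v = lsmult c (alg_act n p v)"
  by (simp add: alg_act_def lin_extend_lsmult)

lemma alg_act_add: "alg_act n p (u + v) = alg_act n p u + alg_act n p v"
  by (simp add: alg_act_def word_op_add lin_extend_fun_add)

lemma alg_act_lsmult: "alg_act n p (lsmult c v) = lsmult c (alg_act n p v)"
  by (simp add: alg_act_def word_op_lsmult lsmult_lin_extend)

lemma alg_act_zero: "alg_act n p 0 = 0"
  using alg_act_lsmult [of n p 0 0] by simp

lemma alg_act_mult: "alg_act n (p * q) v = alg_act n p (alg_act n q v)"
proof -
  have "alg_act n (p * q) v = lin_extend (\<lambda>u. alg_act n (basis_vec u * q) v) p"
    unfolding alg_act_def by (subst mult_eq_lin_extend) (simp add: lin_extend_lin_extend)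
  also have "(\<lambda>u. alg_act n (basis_vec u * q) v) = (\<lambda>u. word_op n u (alg_act n q v))"
    by (simp add: alg_act_def basis_vec_mult_eq_lin_extend lin_extend_lin_extend word_op_plus
        word_op_lin_extend)
  finally show ?thesis by (simp add: alg_act_def)
qed

lemma alg_act_one: "alg_act n 1 v = v"
proof -
  have "(1 :: free_alg) = basis_vec 0" by (simp add: basis_vec_def)
  then have "alg_act n 1 v = alg_act n (basis_vec 0) v" by (rule arg_cong)
  also have "\<dots> = v" by (simp add: alg_act_def word_op_def letters_zero)
  finally show ?thesis .
qed

lemma alg_act_gen: "alg_act n (gen i) v = tl_op n i v"
  by (simp add: alg_act_def gen_eq_basis_vec word_op_def)

lemma alg_act_V:
  assumes "p \<in> carrier (free_algebra {1..2*n-1})" "v \<in> V n"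
  shows "alg_act n p v \<in> V n"
  unfolding alg_act_def
  using assms by (intro V_lin_extend word_op_V) (auto simp: free_algebra_def)

text \<open>Closure under right multiplication uses that the free algebra maps \<open>V n\<close>
  into itself: \<open>a\<close> still kills the vector once \<open>x\<close> has acted. The ideal
  \<open>tl_ideal\<close> is the smallest one containing the relators, so placing the relators in
  the annihilator is enough.\<close>

lemma ideal_annihilator:
  "ideal {p \<in> carrier (free_algebra {1..2*n-1}). \<forall>v\<in>V n. alg_act n p v = 0} (free_algebra {1..2*n-1})"
    (is "ideal ?K ?R")
proof (rule idealI [OF ring_free_algebra])
  interpret R: ring ?R by (rule ring_free_algebra)
  show "subgroup ?K (add_monoid ?R)"
  proof (rule group.subgroupI [OF R.a_group])
    show "?K \<subseteq> carrier (add_monoid ?R)" by auto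
    have "0 \<in> ?K" by (simp add: free_algebra_def alg_act_def)
    then show "?K \<noteq> {}" by blast
  next
    fix p assume p: "p \<in> ?K"
    then have pc: "p \<in> carrier ?R" by simp
    \<comment> \<open>The inverse in the record is an abstract one; it is identified with
      \<open>0 - p\<close> so that additivity of the action applies.\<close>
    have "\<ominus>\<^bsub>?R\<^esub> p + p = 0"
      using R.l_neg [OF pc] by (simp add: free_algebra_simps)
    then have "\<ominus>\<^bsub>?R\<^esub> p = 0 - p" by (simp add: eq_neg_iff_add_eq_0)
    moreover have "alg_act n (0 - p) v = 0" if "v \<in> V n" for v
      unfolding alg_act_minus using p that by (simp add: alg_act_def)
    moreover have "\<ominus>\<^bsub>?R\<^esub> p \<in> carrier ?R" using pc by (rule R.a_inv_closed)
    ultimately show "inv\<^bsub>add_monoid ?R\<^esub> p \<in> ?K" unfolding a_inv_def by simp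
  next
    fix p q assume "p \<in> ?K" "q \<in> ?K"
    then show "p \<otimes>\<^bsub>add_monoid ?R\<^esub> q \<in> ?K"
      using R.a_closed [of p q] by (simp add: free_algebra_simps alg_act_plus)
  qed
next
  fix a x assume a: "a \<in> ?K" and x: "x \<in> carrier ?R"
  then show "x \<otimes>\<^bsub>?R\<^esub> a \<in> ?K" "a \<otimes>\<^bsub>?R\<^esub> x \<in> ?K"
    using carrier_mult alg_act_V by (auto simp: free_algebra_simps alg_act_mult alg_act_zero)
qed

lemma tl_ideal_annihilates:
  assumes p: "p \<in> tl_ideal (2*n)" and v: "v \<in> V n"
  shows "alg_act n p v = 0"
proof -
  let ?K = "{p \<in> carrier (free_algebra {1..2*n-1}). \<forall>v\<in>V n. alg_act n p v = 0}"
  have "alg_act n r v = 0" if "r \<in> tl_relators (2*n)" "v \<in> V n" for r v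
    using that tl_op_square tl_op_braid tl_op_commute unfolding tl_relators_def
    by (auto simp: alg_act_minus alg_act_mult alg_act_gen alg_act_lsmult_left)
  then have "tl_relators (2*n) \<subseteq> ?K"
    using tl_relators_carrier [of "2*n"] by blast
  then have "tl_ideal (2*n) \<subseteq> ?K"
    unfolding tl_ideal_def by (intro ring.genideal_minimal [OF ring_free_algebra] ideal_annihilator)
  then show ?thesis using p v by blast
qed

text \<open>An arbitrary representative may be chosen: two representatives differ by an element of
  the ideal, which acts as zero on \<open>V n\<close>.\<close>

definition tl_act :: "nat \<Rightarrow> free_alg set \<Rightarrow> (nat set set \<Rightarrow>\<^sub>0 laurent) \<Rightarrow> (nat set set \<Rightarrow>\<^sub>0 laurent)" where
  "tl_act n x v = alg_act n (SOME p. p \<in> x) v"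

lemma tl_act_tl_class:
  assumes p: "p \<in> carrier (free_algebra {1..2*n-1})" and v: "v \<in> V n"
  shows "tl_act n (tl_class (2*n) p) v = alg_act n p v"
proof -
  have "(SOME q. q \<in> tl_class (2*n) p) \<in> tl_class (2*n) p"
    using tl_class_mem [OF p] by (rule someI)
  then have "alg_act n ((SOME q. q \<in> tl_class (2*n) p) - p) v = 0"
    by (intro tl_ideal_annihilates tl_class_diff v)
  then show ?thesis by (simp add: tl_act_def alg_act_minus)
qed

lemma tl_action_tl_act: "tl_action (2*n) (V n) (tl_act n)"
proof -
  let ?R = "free_algebra {1..2*n-1}"
  interpret R: ring ?R by (rule ring_free_algebra)
  have one: "1 \<in> carrier ?R" using R.one_closed by (simp add: free_algebra_simps)
  have add: "p + q \<in> carrier ?R" if "p \<in> carrier ?R" "q \<in> carrier ?R" for p q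
    using R.a_closed [OF that] by (simp add: free_algebra_simps)
  have scalar: "tl_scalar (2*n) c \<otimes>\<^bsub>TL (2*n)\<^esub> tl_class (2*n) p = tl_class (2*n) (lsmult c p)"
    if "p \<in> carrier ?R" for c p
    unfolding tl_scalar_def
    using tl_class_hom(1) [OF carrier_lsmult [OF one] that] by (simp add: lsmult_mult_left)
  show ?thesis
    unfolding tl_action_def carrier_TL ball_simps tl_class_one
    by (auto simp: scalar tl_class_hom [symmetric] tl_act_tl_class alg_act_V V_add V_lsmult
        alg_act_add alg_act_lsmult alg_act_plus alg_act_mult alg_act_one alg_act_lsmult_left
        one add carrier_mult carrier_lsmult simp del: One_nat_def)
qed

text \<open>Unitality fixes the action of the empty word, multiplicativity extends it letter by
  letter to all words, and bilinearity to all linear combinations; so the generators determine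
  everything.\<close>

lemma tl_action_unique:
  assumes act: "tl_action (2*n) (V n) act"
    and gen: "\<And>i v. i \<in> {1..2*n-1} \<Longrightarrow> v \<in> V n \<Longrightarrow> act (tl_gen (2*n) i) v = tl_op n i v"
    and p: "p \<in> carrier (free_algebra {1..2*n-1})" and v: "v \<in> V n"
  shows "act (tl_class (2*n) p) v = alg_act n p v"
proof -
  let ?R = "free_algebra {1..2*n-1}" and ?c = "tl_class (2*n)"
  interpret R: ring ?R by (rule ring_free_algebra)
  have one: "1 \<in> carrier ?R" using R.one_closed by (simp add: free_algebra_simps)
  have zero: "0 \<in> carrier ?R" using R.zero_closed by (simp add: free_algebra_simps)
  have plus: "p + q \<in> carrier ?R" if "p \<in> carrier ?R" "q \<in> carrier ?R" for p q
    using R.a_closed [OF that] by (simp add: free_algebra_simps)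
  have inT: "?c q \<in> carrier (TL (2*n))" if "q \<in> carrier ?R" for q
    using that by (simp add: carrier_TL)
  have add: "act (?c (q + r)) v = act (?c q) v + act (?c r) v"
    if "q \<in> carrier ?R" "r \<in> carrier ?R" "v \<in> V n" for q r v
    using act that unfolding tl_action_def by (simp add: tl_class_hom inT)
  have mult: "act (?c (q * r)) v = act (?c q) (act (?c r) v)"
    if "q \<in> carrier ?R" "r \<in> carrier ?R" "v \<in> V n" for q r v
    using act that unfolding tl_action_def by (simp add: tl_class_hom inT)
  have scalar: "act (?c (lsmult c q)) v = lsmult c (act (?c q) v)"
    if "q \<in> carrier ?R" "v \<in> V n" for c q v
  proof -
    have "?c (lsmult c q) = tl_scalar (2*n) c \<otimes>\<^bsub>TL (2*n)\<^esub> ?c q"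
      unfolding tl_scalar_def
      using tl_class_hom(1) [OF carrier_lsmult [OF one] that(1), of c] by (simp add: lsmult_mult_left)
    then show ?thesis using act that unfolding tl_action_def by (simp add: inT)
  qed
  have word: "act (?c (basis_vec (Word l))) v = word_op n (Word l) v"
    if "set l \<subseteq> {1..2*n-1}" "v \<in> V n" for l v
    using that
  proof (induction l)
    case Nil
    have "basis_vec (Word []) = (1 :: free_alg)"
      by (simp add: basis_vec_def flip: zero_free_monoid_def)
    then show ?case
      using act Nil unfolding tl_action_def by (simp add: tl_class_one word_op_def)
  next
    case (Cons i l)
    have l: "basis_vec (Word l) \<in> carrier ?R"
      using Cons.prems by (simp add: basis_vec_def free_algebra_def)
    have "basis_vec (Word (i # l)) = gen i * basis_vec (Word l)"
      by (simp add: gen_eq_basis_vec basis_vec_mult plus_free_monoid_def)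
    then have "act (?c (basis_vec (Word (i # l)))) v = act (?c (gen i)) (word_op n (Word l) v)"
      using mult [OF gen_in_carrier l] Cons by simp
    also have "\<dots> = tl_op n i (word_op n (Word l) v)"
      using gen [of i "word_op n (Word l) v"] Cons.prems word_op_V by (simp add: tl_gen_def)
    finally show ?case by (simp add: word_op_def)
  qed
  have word_carrier: "basis_vec w \<in> carrier ?R" if "w \<in> Poly_Mapping.keys p" for w
    using that p by (simp add: basis_vec_def free_algebra_def)
  \<comment> \<open>Membership in the carrier is carried through the induction because additivity of
    \<open>act\<close> is available only for classes of carrier elements.\<close>
  have "(\<Sum>w\<in>S. lsmult (Poly_Mapping.lookup p w) (basis_vec w)) \<in> carrier ?R \<and>
      act (?c (\<Sum>w\<in>S. lsmult (Poly_Mapping.lookup p w) (basis_vec w))) v =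
      (\<Sum>w\<in>S. lsmult (Poly_Mapping.lookup p w) (word_op n w v))"
    if "finite S" "S \<subseteq> Poly_Mapping.keys p" for S
    using that
  proof (induction S)
    case empty
    have "act (?c 0) v = 0" using add [OF zero zero v] by simp
    then show ?case using zero by simp
  next
    case (insert w S)
    have w: "basis_vec w \<in> carrier ?R" "set (letters w) \<subseteq> {1..2*n-1}"
      using insert.prems word_carrier p by (auto simp: free_algebra_def)
    have "act (?c (basis_vec w)) v = word_op n w v"
      using word [OF w(2) v] by simp
    then show ?case
      using insert w v by (simp add: add plus carrier_lsmult scalar del: One_nat_def)
  qed
  from this [of "Poly_Mapping.keys p"] have "act (?c (lin_extend basis_vec p)) v = alg_act n p v"
    by (simp add: lin_extend_def alg_act_def)
  then show ?thesis by simp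
qed

theorem mainTheorem3:
  fixes n :: nat
  assumes "n \<ge> 2"
  shows
    "(\<forall>i\<in>{1..2*n-1}. \<forall>v\<in>V n. F n i (F n i v) = lsmult tau (F n i v)) \<and>
     (\<forall>i\<in>{1..2*n-2}. \<forall>v\<in>V n.
        F n i (F n (i+1) (F n i v)) = F n i v \<and>
        F n (i+1) (F n i (F n (i+1) v)) = F n (i+1) v) \<and>
     (\<forall>i\<in>{1..2*n-1}. \<forall>j\<in>{1..2*n-1}. \<bar>int i - int j\<bar> > 1 \<longrightarrow>
        (\<forall>v\<in>V n. F n i (F n j v) = F n j (F n i v))) \<and>
     (\<exists>act. tl_action (2*n) (V n) act \<and>
        (\<forall>i\<in>{1..2*n-1}. \<forall>v\<in>V n. act (tl_gen (2*n) i) v = F n i v) \<and>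
        (\<forall>act'. tl_action (2*n) (V n) act' \<and>
                (\<forall>i\<in>{1..2*n-1}. \<forall>v\<in>V n. act' (tl_gen (2*n) i) v = F n i v) \<longrightarrow>
                (\<forall>x\<in>carrier (TL (2*n)). \<forall>v\<in>V n. act' x v = act x v)))"
proof (intro conjI)
  \<comment> \<open>This identification holds only on \<open>V n\<close>; \<open>tl_op_V\<close>
    keeps every intermediate vector there.\<close>
  note F = F_eq_tl_op [OF assms]
  show "\<forall>i\<in>{1..2*n-1}. \<forall>v\<in>V n. F n i (F n i v) = lsmult tau (F n i v)"
  proof (intro ballI)
    fix i v assume i: "i \<in> {1..2*n-1}" and v: "v \<in> V n"
    show "F n i (F n i v) = lsmult tau (F n i v)"
      using tl_op_square [OF v i] by (simp only: F tl_op_V v i)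
  qed
  show "\<forall>i\<in>{1..2*n-2}. \<forall>v\<in>V n.
      F n i (F n (i+1) (F n i v)) = F n i v \<and> F n (i+1) (F n i (F n (i+1) v)) = F n (i+1) v"
  proof (intro ballI)
    fix i v assume i: "i \<in> {1..2*n-2}" and v: "v \<in> V n"
    have i': "i \<in> {1..2*n-1}" "i + 1 \<in> {1..2*n-1}" using i by auto
    show "F n i (F n (i+1) (F n i v)) = F n i v \<and> F n (i+1) (F n i (F n (i+1) v)) = F n (i+1) v"
      using tl_op_braid [OF v i] by (simp only: F tl_op_V v i' Suc_eq_plus1 simp_thms)
  qed
  show "\<forall>i\<in>{1..2*n-1}. \<forall>j\<in>{1..2*n-1}. \<bar>int i - int j\<bar> > 1 \<longrightarrow>
      (\<forall>v\<in>V n. F n i (F n j v) = F n j (F n i v))"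
  proof (intro ballI impI)
    fix i j v
    assume ij: "i \<in> {1..2*n-1}" "j \<in> {1..2*n-1}" "\<bar>int i - int j\<bar> > 1" and v: "v \<in> V n"
    show "F n i (F n j v) = F n j (F n i v)"
      using tl_op_commute [OF v ij] by (simp only: F tl_op_V v ij(1,2))
  qed
  have gen: "tl_act n (tl_gen (2*n) i) v = F n i v" if "i \<in> {1..2*n-1}" "v \<in> V n" for i v
    unfolding tl_gen_def tl_act_tl_class [OF gen_in_carrier [OF that(1)] that(2)] alg_act_gen
    by (rule F [OF that(2,1), symmetric])
  have unique: "act' x v = tl_act n x v"
    if act': "tl_action (2*n) (V n) act'"
      and g: "\<forall>i\<in>{1..2*n-1}. \<forall>v\<in>V n. act' (tl_gen (2*n) i) v = F n i v"
      and x: "x \<in> carrier (TL (2*n))" and v: "v \<in> V n" for act' x v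
  proof -
    obtain p where p: "p \<in> carrier (free_algebra {1..2*n-1})" "x = tl_class (2*n) p"
      using x by (auto simp: carrier_TL)
    have "act' x v = alg_act n p v"
      unfolding p(2) by (rule tl_action_unique [OF act' _ p(1) v]) (simp only: g F)
    then show ?thesis by (simp only: p tl_act_tl_class [OF p(1) v])
  qed
  show "\<exists>act. tl_action (2*n) (V n) act \<and>
      (\<forall>i\<in>{1..2*n-1}. \<forall>v\<in>V n. act (tl_gen (2*n) i) v = F n i v) \<and>
      (\<forall>act'. tl_action (2*n) (V n) act' \<and>
              (\<forall>i\<in>{1..2*n-1}. \<forall>v\<in>V n. act' (tl_gen (2*n) i) v = F n i v) \<longrightarrow>
              (\<forall>x\<in>carrier (TL (2*n)). \<forall>v\<in>V n. act' x v = act x v))"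
    by (intro exI [of _ "tl_act n"] conjI allI impI ballI tl_action_tl_act gen)
      (auto intro: unique)
qed

end
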